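(* Let $\psi(z)=z-1/z$, let $(\lambda_n)_{n\ge 0}$ be defined by $\lambda_0=0$ and $\lambda_{n+1}=\frac12\left(\lambda_n+\sqrt{\lambda_n^2+4}\right)$ for $n\ge 0$, and let $f$ be the meromorphic function on $\mathbb C$ which extends the Bernstein transform of the fixed point measure $\mu$ (see context). Let $a_n,b_n:\mathbb C\to\mathbb C$ be the entire functions defined by $$a_n(z)=\lambda_n\left(\frac{\lambda_n}{\lambda_{n-1}}\right)^z,\ n\ge 2,\qquad b_n(z)=\lambda_n\left(\frac{\lambda_{n+1}}{\lambda_n}\right)^z,\ n\ge 1.$$ Then for every $z\in\mathbb C$ $$f(z)=\lim_{n\to\infty}\psi^{\circ n}(a_n(z))=\lim_{n\to\infty}\psi^{\circ n}(b_n(z)),$$ and the convergence is uniform on compact subsets of $\mathbb C$, where all functions are regarded as maps into the Riemann sphere $\mathbb C^*=\mathbb C\cup\{\infty\}$ and uniformity is with respect to the chordal metric on $\mathbb C^*$.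
   Context: The rational function $\psi(z)=z-1/z$ is regarded as a continuous map of the Riemann sphere $\mathbb C^*=\mathbb C\cup\{\infty\}$ onto itself, with $\psi(0)=\psi(\infty)=\infty$. Iterates are $\psi^{\circ 1}=\psi$ and $\psi^{\circ n}=\psi\circ\psi^{\circ(n-1)}$ for $n\ge 2$. For $x>0$ and $z\in\mathbb C$, $x^z=e^{z\log x}$ with real $\log x$. A meromorphic function takes the value $\infty$ at its poles. The fixed point measure. Let $(m_n)_{n\ge 0}$ be the sequence of positive numbers determined by $m_0=1$ and $(1+m_1+\cdots+m_n)m_n=1$ for $n\ge 1$. It is known (earlier work) that $(m_n)$ is a Hausdorff moment sequence, i.e. there is a (unique) probability measure $\mu$ on $[0,1]$ with $m_n=\int_0^1 t^n\,d\mu(t)$ for all $n\ge 0$; $\mu$ is called the fixed point measure. It is absolutely continuous with respect to Lebesgue measure on $]0,1[$. The numbers $\lambda_n$ above satisfy $\lambda_{n+1}=1/m_n$ for $n\ge 0$. The function $f$. The Bernstein transform of $\mu$ is $$f(z)=\int_0^1\frac{1-t^z}{1-t}\,d\mu(t),\qquad \Re z>0,$$ which is holomorphic in $\Re z>0$. It is known (earlier work) that $f$ extends to a meromorphic function on $\mathbb C$, again denoted $f$, which satisfies $f(z)=\psi(f(z+1))=f(z+1)-\frac{1}{f(z+1)}$ for $z\in\mathbb C$. It is also known that the restriction of $f$ to $]0,\infty[$ is the unique function $]0,\infty[\to]0,\infty[$ such that $f(1)=1$, $\log(1/f)$ is convex, and $f(s)=f(s+1)-1/f(s+1)$ for all $s>0$.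 *)

theory Defs
  imports "HOL-Complex_Analysis.Complex_Analysis" "HOL-Probability.Probability"
begin

section \<open>The Riemann sphere with the chordal metric\<close>

datatype riemann_sphere = Fin complex | Infty

primrec stereo :: "riemann_sphere \<Rightarrow> complex \<times> real" where
  "stereo (Fin z) = (2 * z / of_real (1 + (cmod z)\<^sup>2), ((cmod z)\<^sup>2 - 1) / (1 + (cmod z)\<^sup>2))"
| "stereo Infty = (0, 1)"

fun chordal :: "riemann_sphere \<Rightarrow> riemann_sphere \<Rightarrow> real" where
  "chordal (Fin z) (Fin w) = 2 * cmod (z - w) / (sqrt (1 + (cmod z)\<^sup>2) * sqrt (1 + (cmod w)\<^sup>2))"
| "chordal (Fin z) Infty = 2 / sqrt (1 + (cmod z)\<^sup>2)"
| "chordal Infty (Fin w) = 2 / sqrt (1 + (cmod w)\<^sup>2)"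
| "chordal Infty Infty = 0"

lemma chordal_eq_dist_stereo: "chordal p q = dist (stereo p) (stereo q)"
proof -
  have pos: "1 + (cmod z)\<^sup>2 > 0" for z
    by (simp add: add_pos_nonneg)
  have eq: "chordal p q = dist (stereo p) (stereo q)"
    if "chordal p q \<ge> 0" "(chordal p q)\<^sup>2 = (dist (stereo p) (stereo q))\<^sup>2" for p q
    using that by (simp add: power2_eq_iff_nonneg)
  have inf: "(chordal (Fin z) Infty)\<^sup>2 = (dist (stereo (Fin z)) (stereo Infty))\<^sup>2" for z
  proof -
    define A where "A = 1 + (cmod z)\<^sup>2"
    have A: "A > 0" using pos A_def by simp
    have "(dist (stereo (Fin z)) (stereo Infty))\<^sup>2
        = (cmod (2 * z / of_real A))\<^sup>2 + ((A - 2) / A - 1)\<^sup>2"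
      by (simp only: stereo.simps A_def[symmetric] dist_Pair_Pair)
         (simp add: dist_norm A_def)
    also have "(cmod (2 * z / of_real A))\<^sup>2 = 4 * (A - 1) / A\<^sup>2"
      by (simp add: norm_divide norm_mult power_divide power_mult_distrib A_def del: of_real_add)
    also have "4 * (A - 1) / A\<^sup>2 + ((A - 2) / A - 1)\<^sup>2 = (4 * (A - 1) + 4) / A\<^sup>2"
      using A by (simp add: field_simps power2_eq_square)
    also have "\<dots> = 4 / A"
      using A by (simp add: power2_eq_square)
    finally show ?thesis
      using A by (simp add: A_def power_divide)
  qed
  have fin: "(chordal (Fin z) (Fin w))\<^sup>2 = (dist (stereo (Fin z)) (stereo (Fin w)))\<^sup>2" for z w
  proof -
    obtain x y where z: "z = Complex x y" by (cases z)
    obtain u v where w: "w = Complex u v" by (cases w)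
    define A where "A = 1 + (x\<^sup>2 + y\<^sup>2)"
    define B where "B = 1 + (u\<^sup>2 + v\<^sup>2)"
    have A: "A > 0" and B: "B > 0"
      unfolding A_def B_def by (simp_all add: add_pos_nonneg)
    have nz: "1 + (cmod z)\<^sup>2 = A" "1 + (cmod w)\<^sup>2 = B"
      by (simp_all add: z w A_def B_def cmod_power2)
    have nz': "(cmod z)\<^sup>2 - 1 = A - 2" "(cmod w)\<^sup>2 - 1 = B - 2"
      using nz by simp_all
    have "(dist (stereo (Fin z)) (stereo (Fin w)))\<^sup>2
        = (cmod (2 * z / of_real A - 2 * w / of_real B))\<^sup>2 + ((A - 2) / A - (B - 2) / B)\<^sup>2"
      by (simp only: stereo.simps nz nz' dist_Pair_Pair)
         (simp add: dist_norm)
    also have "(cmod (2 * z / of_real A - 2 * w / of_real B))\<^sup>2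
        = (2 * x / A - 2 * u / B)\<^sup>2 + (2 * y / A - 2 * v / B)\<^sup>2"
      by (simp add: cmod_power2 z w)
    also have "(2 * x / A - 2 * u / B)\<^sup>2 + (2 * y / A - 2 * v / B)\<^sup>2 + ((A - 2) / A - (B - 2) / B)\<^sup>2
        = 4 * ((x - u)\<^sup>2 + (y - v)\<^sup>2) / (A * B)"
    proof -
      have "((2 * x / A - 2 * u / B)\<^sup>2 + (2 * y / A - 2 * v / B)\<^sup>2 + ((A - 2) / A - (B - 2) / B)\<^sup>2)
          = ((2 * x * B - 2 * u * A)\<^sup>2 + (2 * y * B - 2 * v * A)\<^sup>2 + (2 * A - 2 * B)\<^sup>2) / (A * B)\<^sup>2"
        using A B by (simp add: field_simps power2_eq_square)
      also have "(2 * x * B - 2 * u * A)\<^sup>2 + (2 * y * B - 2 * v * A)\<^sup>2 + (2 * A - 2 * B)\<^sup>2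
          = 4 * ((x - u)\<^sup>2 + (y - v)\<^sup>2) * (A * B)"
        unfolding A_def B_def by algebra
      finally show ?thesis
        using A B by (simp add: power2_eq_square)
    qed
    also have "(x - u)\<^sup>2 + (y - v)\<^sup>2 = (cmod (z - w))\<^sup>2"
      by (simp add: cmod_power2 z w)
    finally show ?thesis
      using A B by (simp only: chordal.simps nz power_divide power_mult_distrib) simp
  qed
  show ?thesis
  proof (cases p; cases q)
    fix z w assume *: "p = Fin z" "q = Fin w"
    show ?thesis unfolding * by (rule eq) (use fin in simp_all)
  next
    fix z assume *: "p = Fin z" "q = Infty"
    show ?thesis unfolding * by (rule eq) (use inf in simp_all)
  next
    fix w assume *: "p = Infty" "q = Fin w"
    show ?thesis unfolding * by (rule eq) (use inf in \<open>simp_all add: dist_commute\<close>)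
  next
    assume *: "p = Infty" "q = Infty"
    show ?thesis unfolding * by simp
  qed
qed

lemma chordal_eq_0_iff: "chordal p q = 0 \<longleftrightarrow> p = q"
proof -
  have "1 + (cmod z)\<^sup>2 \<noteq> 0" for z
    using zero_le_power2[of "cmod z"] by linarith
  then show ?thesis
    by (cases p; cases q) auto
qed

instantiation riemann_sphere :: metric_space
begin

definition dist_riemann_sphere :: "riemann_sphere \<Rightarrow> riemann_sphere \<Rightarrow> real" where
  "dist_riemann_sphere = chordal"

definition uniformity_riemann_sphere :: "(riemann_sphere \<times> riemann_sphere) filter" where
  "uniformity_riemann_sphere = (INF e\<in>{0 <..}. principal {(p, q). dist p q < e})"

definition open_riemann_sphere :: "riemann_sphere set \<Rightarrow> bool" where
  "open_riemann_sphere U \<longleftrightarrow> (\<forall>p\<in>U. eventually (\<lambda>(p', q). p' = p \<longrightarrow> q \<in> U) uniformity)"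

instance
proof
  fix p q r :: riemann_sphere
  show "dist p q = 0 \<longleftrightarrow> p = q"
    by (simp add: dist_riemann_sphere_def chordal_eq_0_iff)
  show "dist p q \<le> dist p r + dist q r"
    by (simp add: dist_riemann_sphere_def chordal_eq_dist_stereo dist_triangle2)
qed (simp_all add: uniformity_riemann_sphere_def open_riemann_sphere_def)

end

section \<open>The rational map and the approximating functions\<close>

fun psi :: "riemann_sphere \<Rightarrow> riemann_sphere" where
  "psi (Fin z) = (if z = 0 then Infty else Fin (z - 1 / z))"
| "psi Infty = Infty"

primrec lam :: "nat \<Rightarrow> real" where
  "lam 0 = 0"
| "lam (Suc n) = (lam n + sqrt ((lam n)\<^sup>2 + 4)) / 2"

(* Only n >= 2 is meaningful for a_fun and n >= 1 for b_fun: below that lam 0 = 0 enters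
   as a denominator. *)

definition a_fun :: "nat \<Rightarrow> complex \<Rightarrow> complex" where
  "a_fun n z = of_real (lam n) * of_real (lam n / lam (n - 1)) powr z"

definition b_fun :: "nat \<Rightarrow> complex \<Rightarrow> complex" where
  "b_fun n z = of_real (lam n) * of_real (lam (n + 1) / lam n) powr z"

section \<open>The fixed point measure and its Bernstein transform\<close>

definition fixed_point_sequence :: "(nat \<Rightarrow> real) \<Rightarrow> bool" where
  "fixed_point_sequence m \<longleftrightarrow>
     (\<forall>n. m n > 0) \<and> m 0 = 1 \<and> (\<forall>n\<ge>1. (\<Sum>k\<le>n. m k) * m n = 1)"

definition fixed_point_measure :: "real measure \<Rightarrow> bool" where
  "fixed_point_measure \<mu> \<longleftrightarrow>
     prob_space \<mu> \<and> sets \<mu> = sets (restrict_space borel {0..1}) \<and>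
     (\<exists>m. fixed_point_sequence m \<and> (\<forall>n. m n = (\<integral>t. t ^ n \<partial>\<mu>)))"

(* For Re z > 0 the convention 0 powr z = 0 gives the integrand its limit 1 at t = 0.  At t = 1
   the integrand is 0 / 0 = 0 instead of its limit z; this is immaterial for a fixed point
   measure, where {1} is a null set because the moments m_n tend to 0. *)

definition bernstein_transform :: "real measure \<Rightarrow> complex \<Rightarrow> complex" where
  "bernstein_transform \<mu> z = (\<integral>t. (1 - of_real t powr z) / (1 - of_real t) \<partial>\<mu>)"

text \<open>
  A nicely meromorphic function has no removable singularities, but takes the value
  \<open>0\<close> at its poles; \<open>sphere_map\<close> restores the value \<open>\<infinity>\<close> there.
\<close>

definition sphere_map :: "(complex \<Rightarrow> complex) \<Rightarrow> complex \<Rightarrow> riemann_sphere" where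
  "sphere_map f z = (if is_pole f z then Infty else Fin (f z))"

end

theory Submission
  imports Defs
begin

text \<open>
  At the positive integers the Bernstein transform takes the values \<open>lam n\<close>, so the functional
  equation \<open>f z = f (z + 1) - 1 / f (z + 1)\<close> holds there. Both sides grow polynomially in the right
  half plane, and a bounded holomorphic function on a half plane which vanishes at all positive
  integers is zero (divide by Blaschke products), so the equation holds in the half plane and, by
  meromorphic continuation, everywhere: \<open>f z = (psi ^^ n) (f (z + n))\<close> on the sphere.

  Let \<open>c n z\<close> be \<open>a_fun n z\<close> or \<open>b_fun n z\<close>. Locally uniformly in \<open>z\<close>, both \<open>f (n + z)\<close> and \<open>c n z\<close>
  equal \<open>lam n + z / lam (n + 1)\<close> up to an error of order \<open>1 / lam n ^ 3\<close>, which is \<open>o(1 / n)\<close> because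
  \<open>lam n ^ 2 \<ge> n\<close>. For some fixed \<open>M\<close> both points lie in the half plane \<open>Re w \<ge> lam (n - M)\<close>, which
  \<open>psi\<close> maps into the one for \<open>n - 1\<close>. On the way down to index \<open>M + 1\<close> the iterates of \<open>psi\<close> expand
  distances by a factor of order at most \<open>n\<close>, and the remaining \<open>M + 1\<close> iterations are Lipschitz for
  the chordal metric.
\<close>

section \<open>The map psi on the sphere and the sequence lam\<close>

lemma chordal_Fin_le: "chordal (Fin z) (Fin w) \<le> 2 * dist z w"
proof -
  have "1 * 1 \<le> sqrt (1 + (cmod z)\<^sup>2) * sqrt (1 + (cmod w)\<^sup>2)"
    by (intro mult_mono) auto
  then have "2 * cmod (z - w) / (sqrt (1 + (cmod z)\<^sup>2) * sqrt (1 + (cmod w)\<^sup>2)) \<le> 2 * cmod (z - w) / 1"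
    by (intro divide_left_mono) auto
  then show ?thesis
    by (simp add: dist_norm)
qed

text \<open>With r = |z|, the reverse triangle inequality gives |z - 1/z| >= |r - 1/r|, and then the
  two squares differ by at least 3 ((r - 1/r) / 2)^2. This controls the chordal denominators at
  image points.\<close>

lemma sqrt_1_plus_norm_psi_ge:
  fixes z :: complex
  assumes "z \<noteq> 0"
  shows "sqrt (1 + (cmod (z - 1 / z))\<^sup>2) \<ge> (1 + (cmod z)\<^sup>2) / (2 * cmod z)"
proof (rule real_le_rsqrt)
  define r where "r = cmod z"
  have r: "r > 0"
    using assms by (simp add: r_def)
  have "cmod (z - 1 / z) \<ge> \<bar>r - 1 / r\<bar>"
    using norm_triangle_ineq3[of z "1 / z"] by (simp add: r_def norm_divide)
  then have "(cmod (z - 1 / z))\<^sup>2 \<ge> (r - 1 / r)\<^sup>2"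
    by (metis abs_ge_zero power2_abs power_mono)
  moreover have "1 + (r - 1 / r)\<^sup>2 - ((1 + r\<^sup>2) / (2 * r))\<^sup>2 = 3 * ((r\<^sup>2 - 1) / (2 * r))\<^sup>2"
    using r by (simp add: field_simps power2_eq_square)
  moreover have "3 * ((r\<^sup>2 - 1) / (2 * r))\<^sup>2 \<ge> 0"
    by simp
  ultimately show "((1 + (cmod z)\<^sup>2) / (2 * cmod z))\<^sup>2 \<le> 1 + (cmod (z - 1 / z))\<^sup>2"
    unfolding r_def by linarith
qed

text \<open>Cauchy-Schwarz for the vectors (1, |z|) and (1, |w|). The factor 1 + z w arises from (z
  - 1/z) - (w - 1/w) = (z - w) (1 + z w) / (z w).\<close>

lemma norm_one_plus_mult_le:
  "cmod (1 + z * w) \<le> sqrt (1 + (cmod z)\<^sup>2) * sqrt (1 + (cmod w)\<^sup>2)"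
proof -
  have "(1 + cmod z * cmod w)\<^sup>2 \<le> (1 + (cmod z)\<^sup>2) * (1 + (cmod w)\<^sup>2)"
    using zero_le_power2[of "cmod z - cmod w"] by (simp add: power2_eq_square algebra_simps)
  then have "1 + cmod z * cmod w \<le> sqrt ((1 + (cmod z)\<^sup>2) * (1 + (cmod w)\<^sup>2))"
    by (rule real_le_rsqrt)
  moreover have "cmod (1 + z * w) \<le> 1 + cmod z * cmod w"
    using norm_triangle_ineq[of 1 "z * w"] by (simp add: norm_mult)
  ultimately show ?thesis
    by (simp add: real_sqrt_mult)
qed

lemma chordal_psi_Infty_le:
  assumes "w \<noteq> 0"
  shows "chordal (psi (Fin w)) Infty \<le> 4 * cmod w / (1 + (cmod w)\<^sup>2)"
proof -
  have pos: "1 + (cmod w)\<^sup>2 > 0" "1 + (cmod (w - 1 / w))\<^sup>2 > 0"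
    by (simp_all add: add_pos_nonneg)
  have "chordal (psi (Fin w)) Infty = 2 / sqrt (1 + (cmod (w - 1 / w))\<^sup>2)"
    using assms by simp
  also have "\<dots> \<le> 2 / ((1 + (cmod w)\<^sup>2) / (2 * cmod w))"
    using sqrt_1_plus_norm_psi_ge[OF assms] pos assms
    by (intro divide_left_mono mult_pos_pos divide_pos_pos) auto
  finally show ?thesis
    by simp
qed

text \<open>The denominator z w in the difference of the two images cancels against the chordal
  weights there. The points 0 and \<open>Infty\<close> need separate cases because
  \<open>psi\<close> sends both to \<open>Infty\<close>.\<close>

lemma chordal_psi_le: "chordal (psi p) (psi q) \<le> 4 * chordal p q"
proof -
  have sym: "chordal p q = chordal q p" for p q
    by (simp add: chordal_eq_dist_stereo dist_commute)
  have nn: "chordal p q \<ge> 0" for p q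
    by (simp add: chordal_eq_dist_stereo)
  have inf: "chordal (psi (Fin w)) (psi Infty) \<le> 4 * chordal (Fin w) Infty" for w
  proof (cases "w = 0")
    case False
    define W where "W = sqrt (1 + (cmod w)\<^sup>2)"
    have W: "W > 0" "W\<^sup>2 = 1 + (cmod w)\<^sup>2" "cmod w \<le> W"
      by (auto simp: W_def add_pos_nonneg intro: real_le_rsqrt)
    have "chordal (psi (Fin w)) Infty \<le> 4 * cmod w / W\<^sup>2"
      using chordal_psi_Infty_le[OF False] by (simp only: W(2))
    also have "\<dots> = 4 * (cmod w / W) / W"
      by (simp add: power2_eq_square)
    also have "\<dots> \<le> 8 / W"
      using W by (intro divide_right_mono) (auto simp: divide_le_eq)
    finally have "chordal (psi (Fin w)) Infty \<le> 8 / sqrt (1 + (cmod w)\<^sup>2)"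
      by (simp only: W_def)
    then show ?thesis
      by simp
  qed auto
  have zero: "chordal (psi (Fin w)) (psi (Fin 0)) \<le> 4 * chordal (Fin w) (Fin 0)" for w
  proof (cases "w = 0")
    case False
    define W where "W = sqrt (1 + (cmod w)\<^sup>2)"
    have W: "W > 0" "W\<^sup>2 = 1 + (cmod w)\<^sup>2"
      by (auto simp: W_def add_pos_nonneg)
    have W1: "W \<ge> 1"
      by (simp add: W_def)
    have "chordal (psi (Fin w)) Infty \<le> 4 * cmod w / W\<^sup>2"
      using chordal_psi_Infty_le[OF False] by (simp only: W(2))
    also have "\<dots> = 4 * cmod w / W * (1 / W)"
      by (simp add: power2_eq_square)
    also have "\<dots> \<le> 4 * cmod w / W * 2"
      using W W1 by (intro mult_left_mono) (auto simp: field_simps)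
    finally show ?thesis
      by (simp add: W_def)
  qed auto
  have fin: "chordal (psi (Fin z)) (psi (Fin w)) \<le> 4 * chordal (Fin z) (Fin w)"
    if z: "z \<noteq> 0" and w: "w \<noteq> 0" for z w
  proof -
    define Z where "Z = sqrt (1 + (cmod z)\<^sup>2)"
    define W where "W = sqrt (1 + (cmod w)\<^sup>2)"
    have Z: "Z > 0" "Z\<^sup>2 = 1 + (cmod z)\<^sup>2" and W: "W > 0" "W\<^sup>2 = 1 + (cmod w)\<^sup>2"
      by (auto simp: Z_def W_def add_pos_nonneg)
    have eq: "(z - 1 / z) - (w - 1 / w) = (z - w) * (1 + z * w) / (z * w)"
      using z w by (simp add: field_simps)
    have "chordal (psi (Fin z)) (psi (Fin w))
        = 2 * cmod ((z - 1 / z) - (w - 1 / w))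
          / (sqrt (1 + (cmod (z - 1 / z))\<^sup>2) * sqrt (1 + (cmod (w - 1 / w))\<^sup>2))"
      using z w by simp
    also have "\<dots> \<le> 2 * cmod ((z - 1 / z) - (w - 1 / w)) / (Z\<^sup>2 / (2 * cmod z) * (W\<^sup>2 / (2 * cmod w)))"
      using sqrt_1_plus_norm_psi_ge[OF z] sqrt_1_plus_norm_psi_ge[OF w] z w Z W
      by (intro divide_left_mono mult_mono mult_pos_pos) (auto simp: add_pos_nonneg)
    also have "\<dots> = 8 * cmod (z - w) * cmod (1 + z * w) / (Z\<^sup>2 * W\<^sup>2)"
      unfolding eq norm_divide norm_mult using z w by (simp add: field_simps)
    also have "\<dots> \<le> 8 * cmod (z - w) * (Z * W) / (Z\<^sup>2 * W\<^sup>2)"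
      unfolding Z_def W_def
      by (intro divide_right_mono mult_left_mono norm_one_plus_mult_le) auto
    also have "\<dots> = 4 * chordal (Fin z) (Fin w)"
      unfolding chordal.simps Z_def[symmetric] W_def[symmetric]
      using Z(1) W(1) by (simp add: power2_eq_square)
    finally show ?thesis .
  qed
  show ?thesis
  proof (cases p; cases q)
    fix z w assume "p = Fin z" "q = Fin w"
    then show ?thesis
      using fin[of z w] zero[of z] zero[of w] sym by (cases "z = 0"; cases "w = 0") metis+
  next
    fix z assume "p = Fin z" "q = Infty"
    then show ?thesis
      using inf by metis
  next
    fix w assume "p = Infty" "q = Fin w"
    then show ?thesis
      using inf sym by metis
  qed auto
qed

lemma dist_psi_funpow_le: "dist ((psi ^^ n) p) ((psi ^^ n) q) \<le> 4 ^ n * dist p q"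
proof (induction n)
  case (Suc n)
  have "dist ((psi ^^ Suc n) p) ((psi ^^ Suc n) q) \<le> 4 * dist ((psi ^^ n) p) ((psi ^^ n) q)"
    by (simp add: dist_riemann_sphere_def chordal_psi_le)
  with Suc show ?case
    by (simp add: mult.assoc)
qed simp

lemma isCont_psi: "isCont psi p"
proof -
  have "lipschitz_on 4 UNIV psi"
    by (intro lipschitz_onI) (simp_all add: dist_riemann_sphere_def chordal_psi_le)
  then show ?thesis
    using lipschitz_on_continuous_on continuous_on_eq_continuous_at open_UNIV by blast
qed

lemma tendsto_Fin:
  assumes "(g \<longlongrightarrow> c) F"
  shows "((\<lambda>x. Fin (g x)) \<longlongrightarrow> Fin c) F"
proof (rule tendstoI)
  fix e :: real assume "e > 0"
  then have "\<forall>\<^sub>F x in F. dist (g x) c < e / 2"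
    using tendstoD[OF assms, of "e / 2"] by simp
  then show "\<forall>\<^sub>F x in F. dist (Fin (g x)) (Fin c) < e"
  proof eventually_elim
    case (elim x)
    then show ?case
      using chordal_Fin_le[of "g x" c] unfolding dist_riemann_sphere_def by linarith
  qed
qed

lemma tendsto_Infty:
  assumes "filterlim g at_infinity F"
  shows "((\<lambda>x. Fin (g x)) \<longlongrightarrow> Infty) F"
proof (rule tendstoI)
  fix e :: real assume e: "e > 0"
  have "\<forall>\<^sub>F x in F. cmod (g x) \<ge> 2 / e + 1"
    using assms e by (subst (asm) filterlim_at_infinity[of 0]) (auto simp: add_pos_pos)
  then show "\<forall>\<^sub>F x in F. dist (Fin (g x)) Infty < e"
  proof eventually_elim
    case (elim x)
    then have "2 / e < cmod (g x)"
      by linarith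
    also have "\<dots> \<le> sqrt (1 + (cmod (g x))\<^sup>2)"
      by (rule real_le_rsqrt) simp
    finally show ?case
      using e by (simp add: dist_riemann_sphere_def field_simps add_pos_nonneg)
  qed
qed

section \<open>Recursion and growth of the sequence \<open>lam\<close>\<close>

lemma lam_pos: "lam (Suc n) > 0"
proof -
  have "\<bar>lam n\<bar> < sqrt ((lam n)\<^sup>2 + 4)"
    by (rule real_less_rsqrt) simp
  then show ?thesis
    by simp
qed

lemma lam_nonneg: "lam n \<ge> 0"
  using lam_pos by (cases n) (auto simp del: lam.simps(2) intro: less_imp_le)

text \<open>The square root in the recursion disappears because (x - 1/x)^2 + 4 = (x + 1/x)^2. So
  \<open>lam (Suc n)\<close> is the positive preimage of \<open>lam n\<close> under x - 1/x.\<close>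

lemma lam_Suc_eqI:
  assumes "x > 0" "x - 1 / x = lam n"
  shows "lam (Suc n) = x"
proof -
  have "(lam n)\<^sup>2 + 4 = (x + 1 / x)\<^sup>2"
    unfolding assms(2)[symmetric] using assms(1) by (simp add: field_simps power2_eq_square)
  then have "sqrt ((lam n)\<^sup>2 + 4) = x + 1 / x"
    using assms(1) by simp
  then show ?thesis
    using assms(2) by simp
qed

lemma lam_rec: "lam n = lam (Suc n) - 1 / lam (Suc n)"
proof -
  define s where "s = sqrt ((lam n)\<^sup>2 + 4)"
  have "s\<^sup>2 = (lam n)\<^sup>2 + 4"
    by (simp add: s_def add_nonneg_pos)
  then have "lam (Suc n) * lam (Suc n) - 1 = lam n * lam (Suc n)"
    by (simp add: s_def[symmetric] field_simps power2_eq_square)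
  then show ?thesis
    using lam_pos[of n] by (simp add: field_simps del: lam.simps)
qed

lemma lam_mono_Suc: "lam n \<le> lam (Suc n)"
  using lam_rec[of n] lam_pos[of n] by (simp del: lam.simps)

lemma lam_mono: "m \<le> n \<Longrightarrow> lam m \<le> lam n"
  using lift_Suc_mono_le[of lam] lam_mono_Suc by blast

lemma lam_ge_1: "n \<ge> 1 \<Longrightarrow> lam n \<ge> 1"
  using lam_mono[of 1 n] by simp

text \<open>Squaring \<open>lam_rec\<close> turns the cross term into the constant 2, so the squares
  grow by an amount between 1 and 2 in each step.\<close>

lemma lam_sq_Suc: "(lam (Suc n))\<^sup>2 = (lam n)\<^sup>2 + 2 - 1 / (lam (Suc n))\<^sup>2"
proof -
  have "(lam n)\<^sup>2 = (lam (Suc n) - 1 / lam (Suc n))\<^sup>2"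
    using lam_rec[of n] by simp
  then show ?thesis
    using lam_pos[of n] by (simp add: field_simps power2_eq_square del: lam.simps)
qed

lemma lam_sq_Suc_ge: "(lam (Suc n))\<^sup>2 \<ge> (lam n)\<^sup>2 + 1"
proof -
  have "1 / (lam (Suc n))\<^sup>2 \<le> 1"
    using lam_ge_1[of "Suc n"] by (simp del: lam.simps)
  then show ?thesis
    using lam_sq_Suc[of n] by linarith
qed

lemma lam_sq_Suc_le: "(lam (Suc n))\<^sup>2 \<le> (lam n)\<^sup>2 + 2"
proof -
  have "1 / (lam (Suc n))\<^sup>2 \<ge> 0"
    by simp
  then show ?thesis
    using lam_sq_Suc[of n] by linarith
qed

lemma lam_sq_ge: "(lam n)\<^sup>2 \<ge> n"
proof (induction n)
  case (Suc n)
  then show ?case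
    using lam_sq_Suc_ge[of n] by (simp del: lam.simps)
qed simp

text \<open>Each of the \<open>k\<close> steps adds the reciprocal of a later term, which is at
  least \<open>1 / lam (n + k)\<close> by monotonicity. The gain later absorbs the real-part error
  of the approximating functions.\<close>

lemma lam_add_ge: "n \<ge> 1 \<Longrightarrow> lam (n + k) \<ge> lam n + k / lam (n + k)"
proof (induction k)
  case (Suc k)
  have pos: "lam (n + k) > 0" "lam (n + Suc k) > 0"
    using lam_ge_1[of "n + k"] lam_ge_1[of "n + Suc k"] Suc.prems by linarith+
  have "k / lam (n + Suc k) \<le> k / lam (n + k)"
    using pos lam_mono[of "n + k" "n + Suc k"] by (intro divide_left_mono mult_pos_pos) auto
  moreover have "lam (n + Suc k) = lam (n + k) + 1 / lam (n + Suc k)"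
    using lam_rec[of "n + k"] by (simp del: lam.simps)
  moreover have "Suc k / lam (n + Suc k) = k / lam (n + Suc k) + 1 / lam (n + Suc k)"
    by (simp add: add_divide_distrib)
  ultimately show ?case
    using Suc by linarith
qed (simp del: lam.simps)

section \<open>Bounded holomorphic functions on a half plane\<close>

lemma norm_diff_less_norm_add:
  fixes z :: complex and a :: real
  assumes "Re z > 0" "a > 0"
  shows "cmod (z - of_real a) < cmod (z + of_real a)"
proof -
  have "(cmod (z - of_real a))\<^sup>2 < (cmod (z + of_real a))\<^sup>2"
    using assms unfolding cmod_power2 by (simp add: power2_eq_square algebra_simps)
  then show ?thesis
    by (rule power2_less_imp_less) simp
qed

text \<open>The Schwarz lemma, transported by the Cayley map \<open>c\<close> from the unit disc to
  the half plane with \<open>c 0 = a\<close>. Scaling by \<open>M + e\<close> gives the strict bound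
  which that lemma requires, also when \<open>M\<close> is 0.\<close>

lemma schwarz_half_plane:
  fixes q :: "complex \<Rightarrow> complex" and a :: real
  assumes hol: "q holomorphic_on {z. Re z > 0}"
    and bound: "\<And>z. Re z > 0 \<Longrightarrow> cmod (q z) \<le> M"
    and a: "a > 0" "q (of_real a) = 0" and z: "Re z > 0"
  shows "cmod (q z) \<le> M * cmod ((z - of_real a) / (z + of_real a))"
proof (rule field_le_epsilon)
  fix e :: real assume e: "e > 0"
  define c where "c w = of_real a * (1 + w) / (1 - w)" for w :: complex
  define w where "w = (z - of_real a) / (z + of_real a)"
  define g where "g u = q (c u) / of_real (M + e)" for u
  have M: "M \<ge> 0"
    using bound[of 1] norm_ge_zero[of "q 1"] by (simp del: norm_ge_zero)
  have Re_c: "Re (c u) > 0" if "cmod u < 1" for u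
  proof -
    have u1: "1 - u \<noteq> 0"
      using that by auto
    have "c u = of_real a * ((1 + u) * cnj (1 - u)) / of_real ((cmod (1 - u))\<^sup>2)"
      unfolding c_def using u1 by (simp add: complex_norm_square del: of_real_power)
    then have "Re (c u) = a * Re ((1 + u) * cnj (1 - u)) / (cmod (1 - u))\<^sup>2"
      by (simp only: Re_divide_of_real Re_complex_of_real of_real_mult mult.assoc) (simp add: algebra_simps)
    also have "Re ((1 + u) * cnj (1 - u)) = 1 - (cmod u)\<^sup>2"
      unfolding cmod_power2 by (simp add: algebra_simps power2_eq_square)
    finally show ?thesis
      using a u1 that by (simp add: abs_square_less_1)
  qed
  have za: "z + of_real a \<noteq> 0"
    using z a by (auto simp: complex_eq_iff)
  have w: "cmod w < 1"
    using norm_diff_less_norm_add[OF z a(1)] za by (simp add: w_def norm_divide)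
  have "1 - w = 2 * of_real a / (z + of_real a)" "1 + w = 2 * z / (z + of_real a)"
    using za by (simp_all add: w_def field_simps)
  then have cw: "c w = z"
    using a za by (simp add: c_def)
  have "cmod (g w) \<le> cmod w"
  proof (rule Schwarz_Lemma(1)[of g])
    have "c holomorphic_on ball 0 1"
      unfolding c_def by (intro holomorphic_intros) auto
    moreover have "c ` ball 0 1 \<subseteq> {z. Re z > 0}"
      using Re_c by auto
    ultimately have "(q \<circ> c) holomorphic_on ball 0 1"
      using hol holomorphic_on_compose_gen by blast
    then show "g holomorphic_on ball 0 1"
      unfolding g_def o_def using M e by (intro holomorphic_intros) (auto simp: complex_eq_iff)
    show "g 0 = 0"
      using a by (simp add: g_def c_def)
    show "cmod (g u) < 1" if "cmod u < 1" for u
      using bound[OF Re_c[OF that]] M e by (simp add: g_def norm_divide del: of_real_add)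
  qed (fact w)
  then have "cmod (q z) \<le> (M + e) * cmod w"
    using M e by (simp add: g_def cw norm_divide field_simps del: of_real_add)
  also have "\<dots> \<le> M * cmod w + e"
    using e w by (simp add: algebra_simps)
  finally show "cmod (q z) \<le> M * cmod ((z - of_real a) / (z + of_real a)) + e"
    by (simp add: w_def)
qed

text \<open>The quotient extends holomorphically over its removable singularity at \<open>a\<close>.
  Away from \<open>a\<close> the bound \<open>M\<close> survives division by the Schwarz estimate,
  and at \<open>a\<close> it follows by continuity.\<close>

lemma divide_blaschke_factor:
  fixes q :: "complex \<Rightarrow> complex" and a :: real
  assumes hol: "q holomorphic_on {z. Re z > 0}"
    and bound: "\<And>z. Re z > 0 \<Longrightarrow> cmod (q z) \<le> M"
    and a: "a > 0" "q (of_real a) = 0"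
  obtains q' where "q' holomorphic_on {z. Re z > 0}"
    "\<And>z. Re z > 0 \<Longrightarrow> cmod (q' z) \<le> M"
    "\<And>z. Re z > 0 \<Longrightarrow> q z = (z - of_real a) / (z + of_real a) * q' z"
proof -
  let ?a = "complex_of_real a"
  let ?H = "{z. Re z > 0}"
  define d where "d z = (if z = ?a then deriv q ?a else (q z - q ?a) / (z - ?a))" for z
  define q' where "q' z = (z + ?a) * d z" for z
  have H: "open ?H"
    by (rule open_halfspace_Re_gt)
  have hd: "d holomorphic_on ?H"
    unfolding d_def using hol H by (rule pole_lemma_open)
  have hq: "q' holomorphic_on ?H"
    unfolding q'_def by (intro holomorphic_intros hd)
  have za: "z + ?a \<noteq> 0" if "Re z > 0" for z
    using that a by (auto simp: complex_eq_iff)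
  have b: "cmod (q' z) \<le> M" if z: "Re z > 0" "z \<noteq> ?a" for z
  proof -
    have "cmod (q' z) = cmod (z + ?a) * cmod (q z) / cmod (z - ?a)"
      using z a by (simp add: q'_def d_def norm_mult norm_divide)
    also have "\<dots> \<le> cmod (z + ?a) * (M * cmod ((z - ?a) / (z + ?a))) / cmod (z - ?a)"
      by (intro divide_right_mono mult_left_mono schwarz_half_plane[OF hol bound a z(1)]) auto
    also have "\<dots> = M"
      using z za[OF z(1)] by (simp add: norm_divide)
    finally show ?thesis .
  qed
  have "(q' \<longlongrightarrow> q' ?a) (at ?a)"
    using holomorphic_on_imp_continuous_on[OF hq] a
    by (intro isContD) (simp add: continuous_on_eq_continuous_at[OF H])
  moreover have "\<forall>\<^sub>F z in at ?a. cmod (q' z) \<le> M"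
  proof -
    have "\<forall>\<^sub>F z in at ?a. z \<in> ?H - {?a}"
      using H a by (intro eventually_at_in_open) auto
    then show ?thesis
      by eventually_elim (use b in auto)
  qed
  ultimately have "cmod (q' ?a) \<le> M"
    by (intro tendsto_upperbound[OF tendsto_norm]) auto
  with b have "cmod (q' z) \<le> M" if "Re z > 0" for z
    using that by blast
  moreover have "q z = (z - ?a) / (z + ?a) * q' z" if "Re z > 0" for z
    using za[OF that] a by (simp add: q'_def d_def)
  ultimately show ?thesis
    using that hq by blast
qed

text \<open>Induction on \<open>N\<close>: the first \<open>N\<close> factors do not vanish at N +
  1, so the quotient \<open>q\<close> inherits the zero there, and one more factor splits off at no
  cost in the bound.\<close>

lemma divide_blaschke_product:
  fixes h :: "complex \<Rightarrow> complex"
  assumes hol: "h holomorphic_on {z. Re z > 0}"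
    and bound: "\<And>z. Re z > 0 \<Longrightarrow> cmod (h z) \<le> M"
    and zero: "\<And>n. n \<ge> 1 \<Longrightarrow> h (of_nat n) = 0"
  shows "\<exists>q. q holomorphic_on {z. Re z > 0} \<and> (\<forall>z. Re z > 0 \<longrightarrow> cmod (q z) \<le> M) \<and>
    (\<forall>z. Re z > 0 \<longrightarrow> h z = (\<Prod>k=1..N. (z - of_nat k) / (z + of_nat k)) * q z)"
proof (induction N)
  case 0
  then show ?case
    using hol bound by auto
next
  case (Suc N)
  then obtain q where q: "q holomorphic_on {z. Re z > 0}" "\<And>z. Re z > 0 \<Longrightarrow> cmod (q z) \<le> M"
    "\<And>z. Re z > 0 \<Longrightarrow> h z = (\<Prod>k=1..N. (z - of_nat k) / (z + of_nat k)) * q z"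
    by blast
  have "(\<Prod>k=1..N. (of_nat (Suc N) - of_nat k) / (of_nat (Suc N) + of_nat k :: complex)) \<noteq> 0"
  proof (subst prod_zero_iff)
    have "of_nat (Suc N) - of_nat k \<noteq> (0::complex)" "of_nat (Suc N) + of_nat k \<noteq> (0::complex)"
      if "k \<in> {1..N}" for k
      using that by (simp_all del: of_nat_Suc of_nat_add add: of_nat_add[symmetric])
    then show "\<not> (\<exists>k\<in>{1..N}. (of_nat (Suc N) - of_nat k) / (of_nat (Suc N) + of_nat k :: complex) = 0)"
      by (simp del: of_nat_Suc)
  qed auto
  then have "q (of_real (real (Suc N))) = 0"
    using q(3)[of "of_nat (Suc N)"] zero[of "Suc N"] by (simp del: of_nat_Suc)
  then obtain q' where q': "q' holomorphic_on {z. Re z > 0}" "\<And>z. Re z > 0 \<Longrightarrow> cmod (q' z) \<le> M"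
    "\<And>z. Re z > 0 \<Longrightarrow> q z = (z - of_real (real (Suc N))) / (z + of_real (real (Suc N))) * q' z"
    using divide_blaschke_factor[OF q(1,2), of "real (Suc N)"] by auto
  have "h z = (\<Prod>k=1..Suc N. (z - of_nat k) / (z + of_nat k)) * q' z" if "Re z > 0" for z
    using q(3)[OF that] q'(3)[OF that] by (simp del: of_nat_Suc)
  then show ?case
    using q' by blast
qed

text \<open>The factors are (2k - 1) / (2k + 1). The product majorizes the Blaschke product on the
  interval from 1/2 to 1, and its decay to 0 reflects the divergence of the harmonic series.\<close>

lemma prod_half_telescope:
  "(\<Prod>k=1..N. (real k - 1 / 2) / (real k + 1 / 2)) = 1 / (2 * real N + 1)"
proof (induction N)
  case (Suc N)
  have "(\<Prod>k=1..Suc N. (real k - 1 / 2) / (real k + 1 / 2))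
      = 1 / (2 * real N + 1) * ((real (Suc N) - 1 / 2) / (real (Suc N) + 1 / 2))"
    using Suc by simp
  also have "\<dots> = 1 / (2 * real (Suc N) + 1)"
    by (simp add: divide_simps) (simp add: algebra_simps)
  finally show ?case .
qed simp

text \<open>For real x between 1/2 and 1 the Blaschke product forces |h x| <= M / (2N + 1) for every
  N. So \<open>h\<close> vanishes on an interval, and the identity theorem does the rest.\<close>

lemma bounded_zeros_at_naturals_imp_zero:
  fixes h :: "complex \<Rightarrow> complex"
  assumes hol: "h holomorphic_on {z. Re z > 0}"
    and bound: "\<And>z. Re z > 0 \<Longrightarrow> cmod (h z) \<le> M"
    and zero: "\<And>n. n \<ge> 1 \<Longrightarrow> h (of_nat n) = 0"
    and z: "Re z > 0"
  shows "h z = 0"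
proof -
  have M: "M \<ge> 0"
    using bound[of 1] norm_ge_zero[of "h 1"] by (simp del: norm_ge_zero)
  have real_zero: "h (of_real x) = 0" if x: "1 / 2 < x" "x < 1" for x
  proof -
    have le: "cmod (h (of_real x)) \<le> M * (1 / (2 * real N + 1))" for N
    proof -
      obtain q where q: "\<And>z. Re z > 0 \<Longrightarrow> cmod (q z) \<le> M"
        "\<And>z. Re z > 0 \<Longrightarrow> h z = (\<Prod>k=1..N. (z - of_nat k) / (z + of_nat k)) * q z"
        using divide_blaschke_product[OF hol bound zero, of N] by blast
      have "cmod (\<Prod>k=1..N. (of_real x - of_nat k) / (of_real x + of_nat k))
          \<le> (\<Prod>k=1..N. (real k - 1 / 2) / (real k + 1 / 2))"
        unfolding prod_norm[symmetric]
      proof (intro prod_mono conjI norm_ge_zero)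
        fix k assume "k \<in> {1..N}"
        then have k: "real k \<ge> 1"
          by simp
        have "(complex_of_real x - of_nat k) / (of_real x + of_nat k) = of_real ((x - k) / (x + k))"
          by simp
        then have "cmod ((of_real x - of_nat k) / (of_real x + of_nat k)) = (k - x) / (k + x)"
          using k x by (simp only: norm_of_real) (simp add: add.commute)
        also have "\<dots> \<le> (real k - 1 / 2) / (real k + 1 / 2)"
          using k x by (intro frac_le) auto
        finally show "cmod ((of_real x - of_nat k) / (of_real x + of_nat k)) \<le> (real k - 1 / 2) / (real k + 1 / 2)" .
      qed
      then have "cmod (h (of_real x)) \<le> (\<Prod>k=1..N. (real k - 1 / 2) / (real k + 1 / 2)) * M"
        using q[of "of_real x"] x by (auto simp: norm_mult intro!: mult_mono prod_nonneg)
      then show ?thesis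
        unfolding prod_half_telescope by (simp only: mult.commute)
    qed
    have "(\<lambda>N. M * (1 / (2 * real N + 1))) \<longlonglongrightarrow> 0"
      by real_asymp
    then have "cmod (h (of_real x)) \<le> 0"
      using le by (intro tendsto_lowerbound) auto
    then show ?thesis
      by simp
  qed
  \<comment> \<open>3/4 is an arbitrary interior point of the interval on which \<open>h\<close> is
    known to vanish.\<close>
  have islim: "complex_of_real (3 / 4) islimpt (of_real ` {1 / 2<..<1})"
  proof (rule islimpt_isCont_image)
    show "(3 / 4 :: real) islimpt {1 / 2<..<1}"
      by (intro open_imp_islimpt) auto
    show "isCont complex_of_real (3 / 4)"
      by (intro continuous_intros)
    show "\<forall>\<^sub>F y in at (3 / 4). complex_of_real y \<noteq> complex_of_real (3 / 4)"
      unfolding of_real_eq_iff by (simp add: eventually_at_filter)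
  qed
  show ?thesis
  proof (rule analytic_continuation[OF hol _ _ _ _ islim])
    show "open {z. Re z > 0}"
      by (rule open_halfspace_Re_gt)
    show "connected {z. Re z > 0}"
      by (intro convex_connected convex_halfspace_Re_gt)
    show "complex_of_real ` {1 / 2<..<1} \<subseteq> {z. Re z > 0}"
      by auto
  qed (use real_zero z in auto)
qed

section \<open>The Bernstein transform\<close>

lemma of_real_powr_eq_exp:
  "t > 0 \<Longrightarrow> complex_of_real t powr z = exp (of_real (ln t) * z)"
  by (simp add: powr_def Ln_of_real mult.commute)

lemma minus_ln_le:
  fixes t :: real
  assumes "t > 0"
  shows "- ln t \<le> (1 - t) / t"
  using ln_le_minus_one[of "1 / t"] assms by (simp add: ln_div diff_divide_distrib)

text \<open>The derivative of \<open>exp\<close> has norm at most 1 on the closed left half plane,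
  which is convex and contains 0.\<close>

lemma norm_exp_diff_1_le:
  fixes u :: complex
  assumes "Re u \<le> 0"
  shows "cmod (exp u - 1) \<le> cmod u"
proof -
  have "cmod (exp u - exp 0) \<le> 1 * cmod (u - 0)"
  proof (rule field_differentiable_bound[where S = "{u. Re u \<le> 0}"])
    show "(exp has_field_derivative exp z) (at z within {u. Re u \<le> 0})" for z :: complex
      by (rule DERIV_subset[OF DERIV_exp]) simp
  qed (use assms convex_halfspace_Re_le in auto)
  then show ?thesis
    by simp
qed

lemma norm_exp_diff_linear_le:
  fixes u :: complex
  shows "cmod (exp u - 1 - u) \<le> exp (cmod u) * (cmod u)\<^sup>2"
  using Taylor_exp_field[of u 1] by (simp add: numeral_2_eq_2 diff_diff_eq)

abbreviation bernstein_integrand :: "complex \<Rightarrow> real \<Rightarrow> complex" where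
  "bernstein_integrand z t \<equiv> (1 - of_real t powr z) / (1 - of_real t)"

lemma norm_1_minus_of_real: "t \<le> 1 \<Longrightarrow> cmod (1 - of_real t) = 1 - t"
  using norm_of_real[of "1 - t", where ?'a = complex] by simp

text \<open>For t < 1/2 the denominator is harmless and |t powr z| <= 1. For t >= 1/2 the numerator
  is at most -ln t |z| <= (1 - t) / t |z|, which cancels the denominator. At the endpoints the
  integrand has the values 1 and, by division by zero, 0.\<close>

lemma bernstein_integrand_bound:
  assumes z: "Re z > 0" and t: "t \<in> {0..1}"
  shows "cmod (bernstein_integrand z t) \<le> 4 + 2 * cmod z"
proof -
  consider "t = 0" | "t = 1" | "0 < t" "t < 1 / 2" | "1 / 2 \<le> t" "t < 1"
    using t by force
  then show ?thesis
  proof cases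
    case 3
    have "cmod (1 - of_real t powr z) \<le> 1 + cmod (of_real t powr z)"
      by (metis norm_one norm_triangle_ineq4)
    also have "\<dots> \<le> 2"
      using 3 z by (simp add: norm_powr_real_powr powr_le1)
    finally have "cmod (bernstein_integrand z t) \<le> 2 / (1 - t)"
      using 3 by (simp add: norm_divide norm_1_minus_of_real divide_right_mono)
    also have "\<dots> \<le> 2 / (1 / 2)"
      using 3 by (intro divide_left_mono) auto
    also have "\<dots> \<le> 4 + 2 * cmod z"
      by simp
    finally show ?thesis .
  next
    case 4
    then have t0: "t > 0"
      by simp
    have "cmod (1 - of_real t powr z) = cmod (exp (of_real (ln t) * z) - 1)"
      using t0 by (simp add: of_real_powr_eq_exp norm_minus_commute)
    also have "\<dots> \<le> cmod (of_real (ln t) * z)"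
      using z t0 4 by (intro norm_exp_diff_1_le) (auto simp: mult_nonpos_nonneg)
    also have "\<dots> = (- ln t) * cmod z"
      using t0 4 by (simp add: norm_mult)
    also have "\<dots> \<le> (1 - t) / t * cmod z"
      using minus_ln_le[OF t0] by (intro mult_right_mono) auto
    finally have "cmod (bernstein_integrand z t) \<le> (1 - t) / t * cmod z / (1 - t)"
      unfolding norm_divide norm_1_minus_of_real[OF less_imp_le[OF 4(2)]]
      using 4 by (intro divide_right_mono) auto
    also have "\<dots> = cmod z / t"
      using 4 by simp
    also have "\<dots> \<le> cmod z / (1 / 2)"
      using 4 by (intro divide_left_mono) auto
    finally show ?thesis
      by simp
  qed auto
qed

lemma bernstein_integrand_of_nat:
  assumes "n \<ge> 1" "t \<noteq> 1"
  shows "bernstein_integrand (of_nat n) t = of_real (\<Sum>k<n. t ^ k)"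
proof -
  \<comment> \<open>The assumption on \<open>n\<close> covers t = 0, since \<open>0 powr 0\<close>
    is 0 while \<open>0 ^ 0\<close> is 1.\<close>
  have "complex_of_real t powr of_nat n = of_real (t ^ n)"
    using assms by (subst powr_nat') auto
  then have "bernstein_integrand (of_nat n) t = of_real ((1 - t ^ n) / (1 - t))"
    by simp
  also have "(1 - t ^ n) / (1 - t) = (\<Sum>k<n. t ^ k)"
    using assms(2) one_diff_power_eq[of t n] by simp
  finally show ?thesis .
qed

text \<open>With s = -ln t and u = -s z the difference of the integrands is t^n (1 - exp u) / (1 -
  t). Replacing 1 - exp u by s z and then s by 1 - t leaves errors of order (1 - t)^2 times negative
  powers of t, all absorbed by t^(-M). What remains, (1 - t) t^(n - M), integrates to a difference
  of consecutive moments.\<close>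

lemma bernstein_integrand_expansion:
  fixes t R :: real and z :: complex
  assumes t: "0 < t" "t < 1" and z: "cmod z \<le> R" and M: "R + 2 \<le> real M" "M \<le> n"
  shows "cmod (bernstein_integrand (of_nat n + z) t - bernstein_integrand (of_nat n) t - z * of_real (t ^ n))
           \<le> (R + R\<^sup>2) * (t ^ (n - M) - t ^ (n - M + 1))"
proof -
  define s where "s = - ln t"
  have R: "R \<ge> 0"
    using z norm_ge_zero[of z] by linarith
  have s: "0 \<le> s" "s \<le> (1 - t) / t" "1 - t \<le> s"
    using t minus_ln_le ln_le_minus_one[of t] by (auto simp: s_def)
  define u where "u = - (of_real s * z)"
  have ut: "of_real t powr z = exp u"
    using t by (simp add: of_real_powr_eq_exp u_def s_def)
  have norm_u: "cmod u = s * cmod z"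
    using s by (simp add: u_def norm_mult)
  have powM: "x \<le> y \<Longrightarrow> t powr y \<le> t powr x" for x y
    using t by (intro powr_mono') auto
  have s2: "(s - (1 - t)) \<le> (1 - t)\<^sup>2 * (1 / t)"
  proof -
    have "(1 - t) / t - (1 - t) = (1 - t)\<^sup>2 * (1 / t)"
      using t by (simp add: field_simps power2_eq_square)
    then show ?thesis
      using s by linarith
  qed
  have one: "1 / t \<le> t powr (- real M)"
    using powM[of "- real M" "-1"] M R t by (simp add: powr_minus_divide)
  \<comment> \<open>The factor exp |u| costs at most t^(-R) and the square of s <= (1 - t) / t costs
    t^(-2); hence the requirement R + 2 <= M.\<close>
  have A: "cmod (exp u - 1 - u) \<le> t powr (- real M) * ((1 - t)\<^sup>2 * R\<^sup>2)"
  proof -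
    have "cmod (exp u - 1 - u) \<le> exp (cmod u) * (cmod u)\<^sup>2"
      by (rule norm_exp_diff_linear_le)
    also have "\<dots> \<le> exp (s * R) * ((1 - t) / t * R)\<^sup>2"
      unfolding norm_u using s z R t by (intro mult_mono power_mono) (auto intro!: mult_left_mono)
    also have "exp (s * R) = t powr (- R)"
      using t by (simp add: powr_def s_def mult.commute)
    also have "t powr (- R) * ((1 - t) / t * R)\<^sup>2 = t powr (- R - 2) * ((1 - t)\<^sup>2 * R\<^sup>2)"
      using t by (simp add: powr_diff power_divide power_mult_distrib powr_numeral)
    also have "\<dots> \<le> t powr (- real M) * ((1 - t)\<^sup>2 * R\<^sup>2)"
      using M by (intro mult_right_mono powM) auto
    finally show ?thesis .
  qed
  have B: "cmod (z * of_real (s - (1 - t))) \<le> t powr (- real M) * ((1 - t)\<^sup>2 * R)"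
  proof -
    have "cmod (z * of_real (s - (1 - t))) = cmod z * (s - (1 - t))"
      using s by (simp only: norm_mult norm_of_real)
    also have "\<dots> \<le> R * ((1 - t)\<^sup>2 * (1 / t))"
      using z s s2 R by (intro mult_mono) auto
    also have "\<dots> \<le> R * ((1 - t)\<^sup>2 * t powr (- real M))"
      using one R by (intro mult_left_mono) auto
    finally show ?thesis
      by (simp add: mult_ac)
  qed
  have tn: "t ^ n * t powr (- real M) = t ^ (n - M)"
    using t M(2) by (simp add: powr_minus powr_realpow power_diff field_simps)
  have "bernstein_integrand (of_nat n + z) t - bernstein_integrand (of_nat n) t - z * of_real (t ^ n)
      = of_real (t ^ n) * (z * of_real (s - (1 - t)) - (exp u - 1 - u)) / (1 - of_real t)"
  proof -
    have "complex_of_real t powr (of_nat n + z) = of_real (t ^ n) * exp u"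
      using t by (simp add: powr_add ut)
    then have "bernstein_integrand (of_nat n + z) t - bernstein_integrand (of_nat n) t - z * of_real (t ^ n)
        = of_real (t ^ n) * ((1 - exp u) - z * (1 - of_real t)) / (1 - of_real t)"
      using t by (simp add: powr_nat' diff_divide_distrib[symmetric] right_diff_distrib mult_ac)
        (simp add: divide_simps, simp add: algebra_simps)
    also have "(1 - exp u) - z * (1 - of_real t) = z * of_real (s - (1 - t)) - (exp u - 1 - u)"
      by (simp add: u_def algebra_simps)
    finally show ?thesis .
  qed
  then have "cmod (bernstein_integrand (of_nat n + z) t - bernstein_integrand (of_nat n) t - z * of_real (t ^ n))
      = cmod (of_real (t ^ n) * (z * of_real (s - (1 - t)) - (exp u - 1 - u)) / (1 - of_real t))"
    by (rule arg_cong)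
  also have "\<dots> = t ^ n * cmod (z * of_real (s - (1 - t)) - (exp u - 1 - u)) / (1 - t)"
    unfolding norm_divide norm_mult norm_of_real norm_1_minus_of_real[OF less_imp_le[OF t(2)]]
    using t by simp
  also have "\<dots> \<le> t ^ n * (t powr (- real M) * ((1 - t)\<^sup>2 * R) + t powr (- real M) * ((1 - t)\<^sup>2 * R\<^sup>2)) / (1 - t)"
    using t norm_triangle_ineq4[of "z * of_real (s - (1 - t))" "exp u - 1 - u"] A B
    by (intro divide_right_mono mult_left_mono) auto
  also have "\<dots> = (R + R\<^sup>2) * ((1 - t) * (t ^ n * t powr (- real M)))"
    using t by (simp add: field_simps power2_eq_square)
  also have "\<dots> = (R + R\<^sup>2) * (t ^ (n - M) - t ^ (n - M + 1))"
    unfolding tn by (simp add: algebra_simps)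
  finally show ?thesis .
qed

text \<open>The partial sums S_n start at 1 = \<open>lam 1\<close>, and m_n = 1 / S_n gives S_n - 1
  / S_n = S_(n-1), which is the recursion of \<open>lam\<close>.\<close>

lemma fixed_point_sequence_eq:
  assumes "fixed_point_sequence m"
  shows "m n = 1 / lam (Suc n)" and "(\<Sum>k\<le>n. m k) = lam (Suc n)"
proof -
  have pos: "\<And>n. m n > 0" and m0: "m 0 = 1" and eq: "\<And>n. n \<ge> 1 \<Longrightarrow> (\<Sum>k\<le>n. m k) * m n = 1"
    using assms by (auto simp: fixed_point_sequence_def)
  have sum: "(\<Sum>k\<le>n. m k) = lam (Suc n)" for n
  proof (induction n)
    case (Suc n)
    define S where "S = (\<Sum>k\<le>Suc n. m k)"
    have S: "S > 0"
      unfolding S_def using pos by (intro sum_pos) auto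
    have "m (Suc n) = 1 / S"
      using eq[of "Suc n"] S unfolding S_def[symmetric] by (simp add: eq_divide_eq mult.commute)
    moreover have "S = lam (Suc n) + m (Suc n)"
      using Suc by (simp add: S_def del: lam.simps)
    ultimately have "S - 1 / S = lam (Suc n)"
      by linarith
    then show ?case
      unfolding S_def[symmetric] by (rule lam_Suc_eqI[OF S, symmetric])
  qed (simp add: m0)
  show "(\<Sum>k\<le>n. m k) = lam (Suc n)"
    by (rule sum)
  show "m n = 1 / lam (Suc n)"
  proof (cases n)
    case (Suc k)
    then show ?thesis
      using eq[of n] lam_pos[of n] unfolding sum by (simp add: field_simps del: lam.simps)
  qed (simp add: m0)
qed

lemma sum_inverse_lam: "(\<Sum>k<n. 1 / lam (Suc k)) = lam n"
proof (induction n)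
  case (Suc n)
  then show ?case
    using lam_rec[of n] by (simp del: lam.simps)
qed simp

lemma lam_tendsto_at_top: "filterlim lam at_top sequentially"
proof (rule filterlim_at_top_mono)
  show "filterlim (\<lambda>n. sqrt (real n)) at_top sequentially"
    by real_asymp
  show "\<forall>\<^sub>F n in sequentially. sqrt (real n) \<le> lam n"
    using lam_sq_ge lam_nonneg by (intro always_eventually allI real_le_lsqrt) auto
qed

section \<open>Integration against the fixed point measure\<close>

locale fixed_point =
  fixes \<mu> :: "real measure"
  assumes fixed_point: "fixed_point_measure \<mu>"
begin

sublocale prob_space \<mu>
  using fixed_point by (simp add: fixed_point_measure_def)

lemma sets_eq: "sets \<mu> = sets (restrict_space borel {0..1})"
  using fixed_point by (simp add: fixed_point_measure_def)

lemma space_eq: "space \<mu> = {0..1}"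
  using sets_eq_imp_space_eq[OF sets_eq] by (simp add: space_restrict_space)

lemma borel_measurableI:
  "g \<in> borel_measurable borel \<Longrightarrow> g \<in> borel_measurable \<mu>"
  using measurable_restrict_space1 measurable_cong_sets[OF sets_eq refl] by blast

lemma integrable_power [simp]: "integrable \<mu> (\<lambda>t. t ^ n)"
proof (rule integrable_const_bound)
  show "AE t in \<mu>. norm (t ^ n) \<le> 1"
    by (intro AE_I2) (simp add: space_eq power_le_one)
  show "(\<lambda>t. t ^ n) \<in> borel_measurable \<mu>"
    by (intro borel_measurableI borel_measurable_power) simp
qed

lemma moment: "(\<integral>t. t ^ n \<partial>\<mu>) = 1 / lam (Suc n)"
  using fixed_point fixed_point_sequence_eq(1) unfolding fixed_point_measure_def by metis

text \<open>Every power t^n dominates the indicator of {1}, and the moments tend to 0. This makes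
  the default value of the integrand at t = 1 harmless.\<close>

lemma AE_neq_1: "AE t in \<mu>. t \<noteq> 1"
proof -
  have one: "{1} \<in> sets \<mu>"
    unfolding sets_eq by (auto simp: sets_restrict_space image_iff intro!: bexI[of _ "{1}"])
  have "measure \<mu> {1} \<le> 1 / lam (Suc n)" for n
  proof -
    have "measure \<mu> {1} = (\<integral>t. indicator {1} t \<partial>\<mu>)"
      using one sets.sets_into_space by (simp add: Int_absorb2)
    also have "\<dots> \<le> (\<integral>t. t ^ n \<partial>\<mu>)"
      using one by (intro integral_mono integrable_real_indicator)
        (auto simp: space_eq indicator_def emeasure_eq_measure)
    finally show ?thesis
      by (simp only: moment)
  qed
  moreover have "(\<lambda>n. 1 / lam (Suc n)) \<longlonglongrightarrow> 0"
    by (rule tendsto_divide_0[OF tendsto_const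
          filterlim_at_top_imp_at_infinity[OF filterlim_compose[OF lam_tendsto_at_top filterlim_Suc]]])
  ultimately have "measure \<mu> {1} \<le> 0"
    by (intro tendsto_lowerbound) auto
  then have "{1} \<in> null_sets \<mu>"
    using one by (simp add: null_setsI emeasure_eq_measure measure_le_0_iff)
  then show ?thesis
    by (auto dest: AE_not_in)
qed

lemma integrable_bernstein_integrand:
  assumes "Re z > 0"
  shows "integrable \<mu> (bernstein_integrand z)"
proof (rule integrable_const_bound)
  show "AE t in \<mu>. cmod (bernstein_integrand z t) \<le> 4 + 2 * cmod z"
    using bernstein_integrand_bound[OF assms] by (intro AE_I2) (auto simp: space_eq)
  \<comment> \<open>On the unit interval this agrees with the integrand, and it is composed of
    functions whose measurability is immediate.\<close>
  have "(\<lambda>t. (1 - (if t = 0 then 0 else exp (of_real (ln t) * z))) / (1 - of_real t)) \<in> borel_measurable \<mu>"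
    by (intro borel_measurableI) measurable
  moreover have "bernstein_integrand z t = (1 - (if t = 0 then 0 else exp (of_real (ln t) * z))) / (1 - of_real t)"
    if "t \<in> space \<mu>" for t
    using that by (auto simp: space_eq of_real_powr_eq_exp)
  ultimately show "bernstein_integrand z \<in> borel_measurable \<mu>"
    by (rule iffD2[OF measurable_cong, rotated])
qed

lemma norm_bernstein_transform_le:
  assumes "Re z > 0"
  shows "cmod (bernstein_transform \<mu> z) \<le> 4 + 2 * cmod z"
proof -
  have "cmod (bernstein_transform \<mu> z) \<le> (\<integral>t. 4 + 2 * cmod z \<partial>\<mu>)"
    unfolding bernstein_transform_def
    by (rule Bochner_Integration.integral_norm_bound_integral[OF integrable_bernstein_integrand[OF assms]])
       (simp_all add: space_eq bernstein_integrand_bound[OF assms])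
  then show ?thesis
    by (simp add: prob_space)
qed

text \<open>Almost everywhere the integrand is a geometric sum, so the integral is the sum of the
  first \<open>n\<close> moments, which telescopes to \<open>lam n\<close>.\<close>

lemma bernstein_transform_of_nat:
  assumes "n \<ge> 1"
  shows "bernstein_transform \<mu> (of_nat n) = of_real (lam n)"
proof -
  have "bernstein_transform \<mu> (of_nat n) = (\<integral>t. complex_of_real (\<Sum>k<n. t ^ k) \<partial>\<mu>)"
    unfolding bernstein_transform_def
  proof (rule integral_cong_AE)
    show "bernstein_integrand (of_nat n) \<in> borel_measurable \<mu>"
      using assms by (intro borel_measurable_integrable integrable_bernstein_integrand) auto
    show "(\<lambda>t. complex_of_real (\<Sum>k<n. t ^ k)) \<in> borel_measurable \<mu>"
      by (intro borel_measurableI) measurable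
    show "AE t in \<mu>. bernstein_integrand (of_nat n) t = of_real (\<Sum>k<n. t ^ k)"
      using AE_neq_1 by eventually_elim (use assms bernstein_integrand_of_nat in auto)
  qed
  also have "\<dots> = of_real (\<Sum>k<n. 1 / lam (Suc k))"
    by (simp only: integral_complex_of_real Bochner_Integration.integral_sum[OF integrable_power] moment)
  finally show ?thesis
    by (simp only: sum_inverse_lam)
qed

text \<open>Since Re (t powr z) <= t^(Re z) <= t^j, the real part of the integrand is at least its
  value at \<open>j\<close>. This places f (n + z) in a half plane on which \<open>psi\<close>
  expands only slightly.\<close>

lemma Re_bernstein_transform_ge:
  assumes "j \<ge> 1" "Re z \<ge> real j"
  shows "Re (bernstein_transform \<mu> z) \<ge> lam j"
proof -
  have z: "Re z > 0"
    using assms by linarith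
  have j: "Re (of_nat j) > 0"
    using assms by simp
  have "Re (bernstein_integrand (of_nat j) t) \<le> Re (bernstein_integrand z t)" if "t \<in> space \<mu>" for t
  proof (cases "t = 1")
    case False
    with that have t: "0 \<le> t" "t < 1"
      by (auto simp: space_eq)
    have "Re (of_real t powr z) \<le> cmod (of_real t powr z)"
      by (rule complex_Re_le_cmod)
    also have "\<dots> = t powr Re z"
      using t by (simp add: norm_powr_real_powr)
    also have "\<dots> \<le> t powr real j"
      using t assms by (intro powr_mono') auto
    also have "\<dots> = Re (of_real t powr of_nat j)"
      using t by (metis Re_complex_of_real of_real_of_nat_eq powr_of_real)
    finally have "(1 - Re (of_real t powr of_nat j)) / (1 - t) \<le> (1 - Re (of_real t powr z)) / (1 - t)"
      using t by (intro divide_right_mono) auto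
    moreover have "Re (bernstein_integrand w t) = (1 - Re (of_real t powr w)) / (1 - t)" for w
      using Re_divide_of_real[of "1 - of_real t powr w" "1 - t"] by simp
    ultimately show ?thesis
      by simp
  qed simp
  then have "Re (bernstein_transform \<mu> (of_nat j)) \<le> Re (bernstein_transform \<mu> z)"
    unfolding bernstein_transform_def
    using integrable_bernstein_integrand[OF z] integrable_bernstein_integrand[OF j]
    by (simp only: integral_Re[symmetric]) (intro integral_mono integrable_Re)
  then show ?thesis
    using assms by (simp add: bernstein_transform_of_nat)
qed

text \<open>The pointwise expansion is integrated, with t^n contributing
  \<open>1 / lam (Suc n)\<close>. Keeping the bound as a difference of reciprocals preserves the
  decay of order \<open>1 / lam n ^ 3\<close>.\<close>

lemma bernstein_transform_expansion:
  assumes z: "cmod z \<le> R" and M: "R + 2 \<le> real M" "M \<le> n"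
  shows "cmod (bernstein_transform \<mu> (of_nat n + z) - of_real (lam n) - z * of_real (1 / lam (Suc n)))
    \<le> (R + R\<^sup>2) * (1 / lam (Suc (n - M)) - 1 / lam (Suc (n - M + 1)))"
proof -
  have R: "R \<ge> 0"
    using z norm_ge_zero[of z] by linarith
  have n: "n \<ge> 1"
    using R M by linarith
  have "Re (of_nat n + z) > 0"
    using complex_Re_le_cmod[of "-z"] z M by simp
  then have int1: "integrable \<mu> (bernstein_integrand (of_nat n + z))"
    by (rule integrable_bernstein_integrand)
  have int2: "integrable \<mu> (bernstein_integrand (of_nat n))"
    using n by (intro integrable_bernstein_integrand) auto
  have int3: "integrable \<mu> (\<lambda>t. complex_of_real (t ^ n))"
    by (simp del: of_real_power)
  let ?d = "\<lambda>t. bernstein_integrand (of_nat n + z) t - bernstein_integrand (of_nat n) t - z * of_real (t ^ n)"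
  have intd: "integrable \<mu> ?d"
    using int1 int2 int3 by (intro Bochner_Integration.integrable_diff integrable_mult_right)
  have eq: "bernstein_transform \<mu> (of_nat n + z) - of_real (lam n) - z * of_real (1 / lam (Suc n)) = integral\<^sup>L \<mu> ?d"
    unfolding bernstein_transform_of_nat[OF n, symmetric] moment[symmetric] integral_complex_of_real[symmetric]
    unfolding bernstein_transform_def
    using int1 int2 int3 by (simp del: of_real_power)
  have "cmod (integral\<^sup>L \<mu> ?d) \<le> (\<integral>t. cmod (?d t) \<partial>\<mu>)"
    by (rule integral_norm_bound)
  also have "\<dots> \<le> (\<integral>t. (R + R\<^sup>2) * (t ^ (n - M) - t ^ (n - M + 1)) \<partial>\<mu>)"
  proof (rule integral_mono_AE)
    show "integrable \<mu> (\<lambda>t. cmod (?d t))"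
      using intd by (rule integrable_norm)
    show "integrable \<mu> (\<lambda>t. (R + R\<^sup>2) * (t ^ (n - M) - t ^ (n - M + 1)))"
      by (intro Bochner_Integration.integrable_diff integrable_mult_right integrable_power)
    have "AE t in \<mu>. t \<in> {0..1}"
      by (intro AE_I2) (simp add: space_eq)
    with AE_neq_1 show "AE t in \<mu>. cmod (?d t) \<le> (R + R\<^sup>2) * (t ^ (n - M) - t ^ (n - M + 1))"
    proof eventually_elim
      case (elim t)
      show ?case
      proof (cases "t = 0")
        \<comment> \<open>At t = 0 both integrands equal 1 and \<open>0 ^ n\<close> is 0, so the
          left side vanishes.\<close>
        case True
        then show ?thesis
          using n R by (simp add: power_0_left)
      next
        case False
        with elim show ?thesis
          by (intro bernstein_integrand_expansion z M) auto
      qed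
    qed
  qed
  also have "\<dots> = (R + R\<^sup>2) * (1 / lam (Suc (n - M)) - 1 / lam (Suc (n - M + 1)))"
    by (simp only: integral_mult_right_zero Bochner_Integration.integral_diff[OF integrable_power integrable_power] moment)
  finally show ?thesis
    unfolding eq .
qed

end

section \<open>The functional equation\<close>

text \<open>A punctured neighbourhood of \<open>z\<close> contains no poles, so
  \<open>sphere_map f\<close> is \<open>Fin\<close> of \<open>f\<close> there. At a pole the limit
  is \<open>Infty\<close>; elsewhere nicely meromorphic functions are continuous.\<close>

lemma tendsto_sphere_map:
  assumes "f nicely_meromorphic_on UNIV"
  shows "(sphere_map f \<longlongrightarrow> sphere_map f z) (at z)"
proof -
  have mero: "f meromorphic_on UNIV"
    using assms by (simp add: nicely_meromorphic_on_def)
  have "\<forall>\<^sub>F w in at z. \<not> is_pole f w"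
  proof -
    have "\<forall>\<^sub>F w in cosparse UNIV. \<not> is_pole f w"
      using mero by (rule meromorphic_on_imp_not_pole_cosparse)
    then show ?thesis
      by (rule eventually_cosparse_imp_eventually_at) simp
  qed
  then have eq: "\<forall>\<^sub>F w in at z. Fin (f w) = sphere_map f w"
    by eventually_elim (simp add: sphere_map_def)
  have "((\<lambda>w. Fin (f w)) \<longlongrightarrow> sphere_map f z) (at z)"
  proof (cases "is_pole f z")
    case True
    then show ?thesis
      by (simp add: sphere_map_def tendsto_Infty is_pole_def)
  next
    case False
    then have "f \<midarrow>z\<rightarrow> f z"
      using assms by (auto simp: nicely_meromorphic_on_def)
    with False show ?thesis
      by (simp add: sphere_map_def tendsto_Fin)
  qed
  then show ?thesis
    using tendsto_cong[OF eq] by blast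
qed

section \<open>Holomorphy of the extension and its functional equation\<close>

locale bernstein_extension = fixed_point +
  fixes f :: "complex \<Rightarrow> complex"
  assumes nicely_meromorphic: "f nicely_meromorphic_on UNIV"
    and eq_bernstein: "\<And>z. Re z > 0 \<Longrightarrow> f z = bernstein_transform \<mu> z"
begin

lemma norm_f_le: "Re z > 0 \<Longrightarrow> cmod (f z) \<le> 4 + 2 * cmod z"
  by (simp add: eq_bernstein norm_bernstein_transform_le)

lemma not_is_pole:
  assumes "Re z > 0"
  shows "\<not> is_pole f z"
proof
  assume "is_pole f z"
  \<comment> \<open>On the unit ball around \<open>z\<close>, within the half plane, |f| is at most
    4 + 2 (|z| + 1); a pole would force values exceeding this by 1.\<close>
  then have "\<forall>\<^sub>F w in at z. cmod (f w) \<ge> 4 + 2 * (cmod z + 1) + 1"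
    using norm_ge_zero[of z] unfolding is_pole_def filterlim_at_infinity[OF order_refl]
    by (metis add_nonneg_pos add_nonneg_nonneg mult_nonneg_nonneg zero_le_numeral zero_le_one zero_less_one)
  moreover have "\<forall>\<^sub>F w in at z. w \<in> {w. Re w > 0} \<inter> ball z 1"
    using assms by (intro eventually_at_in_open' open_Int open_halfspace_Re_gt open_ball) auto
  ultimately have "\<forall>\<^sub>F w in at z. False"
  proof eventually_elim
    case (elim w)
    have "cmod w \<le> cmod z + cmod (w - z)"
      by (rule norm_triangle_sub)
    then show ?case
      using elim norm_f_le[of w] by (auto simp: dist_norm norm_minus_commute)
  qed
  then show False
    by simp
qed

lemma holomorphic: "f holomorphic_on {z. Re z > 0}"
proof (rule analytic_imp_holomorphic)
  show "f analytic_on {z. Re z > 0}"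
    using not_is_pole nicely_meromorphic_on_subset[OF nicely_meromorphic subset_UNIV]
    by (intro nicely_meromorphic_without_singularities) auto
qed

lemma f_of_nat: "n \<ge> 1 \<Longrightarrow> f (of_nat n) = of_real (lam n)"
  by (simp add: eq_bernstein bernstein_transform_of_nat)

text \<open>The defect of the equation grows at most quadratically and vanishes at the positive
  integers by the recursion of \<open>lam\<close>. Dividing by (z + 1)^2 makes it bounded, so the
  uniqueness lemma applies. The product form avoids dividing by f (z + 1), which keeps the defect
  holomorphic.\<close>

lemma functional_equation_half_plane:
  assumes "Re z > 0"
  shows "f (z + 1) * (f (z + 1) - f z) = 1"
proof -
  define h where "h z = (f (z + 1) * (f (z + 1) - f z) - 1) / (z + 1)\<^sup>2" for z
  have ne: "w + 1 \<noteq> 0" if "Re w > 0" for w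
    using that by (auto simp: complex_eq_iff)
  have "h z = 0"
  proof (rule bounded_zeros_at_naturals_imp_zero[OF _ _ _ assms])
    have "(f \<circ> (\<lambda>w. w + 1)) holomorphic_on {z. Re z > 0}"
      by (rule holomorphic_on_compose_gen[OF _ holomorphic]) (auto intro!: holomorphic_intros)
    then show "h holomorphic_on {z. Re z > 0}"
      unfolding h_def o_def by (intro holomorphic_intros holomorphic) (auto dest: ne)
    \<comment> \<open>For r = |w + 1| >= 1 both values of \<open>f\<close> have norm at most 4 + 2 r
      <= 6 r, and 73 = 6 * 12 + 1.\<close>
    show "cmod (h w) \<le> 73" if w: "Re w > 0" for w
    proof -
      define r where "r = cmod (w + 1)"
      have "Re (w + 1) \<le> r"
        unfolding r_def by (rule complex_Re_le_cmod)
      with w have r: "r \<ge> 1"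
        by simp
      have "cmod w \<le> r"
        unfolding r_def cmod_def using w by (intro real_sqrt_le_mono add_mono) (auto intro: power_mono)
      then have b: "cmod (f w) \<le> 6 * r" "cmod (f (w + 1)) \<le> 6 * r"
        using norm_f_le[of w] norm_f_le[of "w + 1"] w r by (auto simp: r_def[symmetric])
      have "cmod (f (w + 1) * (f (w + 1) - f w) - 1) \<le> cmod (f (w + 1)) * cmod (f (w + 1) - f w) + 1"
        using norm_triangle_ineq4[of "f (w + 1) * (f (w + 1) - f w)" 1] by (simp add: norm_mult)
      also have "\<dots> \<le> 6 * r * (12 * r) + r * r"
        using b norm_triangle_ineq4[of "f (w + 1)" "f w"] r
        by (intro add_mono mult_mono) (auto simp: mult_ge1_I)
      also have "\<dots> = 73 * r\<^sup>2"
        by (simp add: power2_eq_square)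
      finally show ?thesis
        using r by (simp add: h_def norm_divide norm_power r_def[symmetric] divide_le_eq)
    qed
    show "h (of_nat n) = 0" if "n \<ge> 1" for n
    proof -
      have "f (of_nat n + 1) = of_real (lam (Suc n))"
        using f_of_nat[of "Suc n"] by (simp add: add.commute del: lam.simps)
      moreover have "lam (Suc n) * (lam (Suc n) - lam n) = 1"
        using lam_rec[of n] lam_pos[of n] by (simp add: field_simps del: lam.simps)
      ultimately have "f (of_nat n + 1) * (f (of_nat n + 1) - f (of_nat n)) = 1"
        unfolding f_of_nat[OF that] by (metis of_real_1 of_real_diff of_real_mult)
      then show ?thesis
        by (simp add: h_def)
    qed
  qed
  then show ?thesis
    using ne[OF assms] by (simp add: h_def)
qed

text \<open>The equation holds in a punctured neighbourhood of every point by meromorphic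
  continuation. Both sides are continuous into the sphere, so it extends to the point itself, poles
  included.\<close>

lemma sphere_map_eq_psi: "sphere_map f z = psi (sphere_map f (z + 1))"
proof -
  define D where "D w = f (w + 1) * (f (w + 1) - f w) - 1" for w
  have mero: "f meromorphic_on UNIV"
    using nicely_meromorphic by (simp add: nicely_meromorphic_on_def)
  have "(\<lambda>w. f (w + 1)) meromorphic_on UNIV"
    by (intro meromorphic_on_compose[OF mero] analytic_intros) auto
  then have "D meromorphic_on UNIV"
    unfolding D_def by (intro meromorphic_intros mero)
  \<comment> \<open>A meromorphic function on the plane is zero off a sparse set or nonzero off a
    sparse set; the half plane around 1 excludes the latter.\<close>
  then have "eventually (\<lambda>w. D w = 0) (cosparse UNIV) \<or> eventually (\<lambda>w. D w \<noteq> 0) (cosparse UNIV)"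
    by (intro meromorphic_imp_constant_or_avoid) auto
  moreover have "\<not> eventually (\<lambda>w. D w \<noteq> 0) (cosparse UNIV)"
  proof
    assume "eventually (\<lambda>w. D w \<noteq> 0) (cosparse UNIV)"
    then have "\<forall>\<^sub>F w in at 1. D w \<noteq> 0"
      by (rule eventually_cosparse_imp_eventually_at) simp
    moreover have "\<forall>\<^sub>F w in at 1. w \<in> {w::complex. Re w > 0}"
      by (intro eventually_at_in_open' open_halfspace_Re_gt) auto
    ultimately have "\<forall>\<^sub>F w in at (1::complex). False"
      by eventually_elim (simp add: D_def functional_equation_half_plane)
    then show False
      by simp
  qed
  ultimately have D: "eventually (\<lambda>w. D w = 0) (cosparse UNIV)"
    by blast
  have not_pole: "\<forall>\<^sub>F w in at u. \<not> is_pole f w" for u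
    by (rule eventually_cosparse_imp_eventually_at[OF meromorphic_on_imp_not_pole_cosparse[OF mero]]) simp
  have "\<forall>\<^sub>F w in at z. \<not> is_pole f (w + 1)"
    using not_pole[of "z + 1"] unfolding at_to_0[of "z + 1"] at_to_0[of z] eventually_filtermap
    by (simp add: add_ac)
  moreover have "\<forall>\<^sub>F w in at z. D w = 0"
    using D by (rule eventually_cosparse_imp_eventually_at) simp
  ultimately have "\<forall>\<^sub>F w in at z. psi (sphere_map f (w + 1)) = sphere_map f w"
    using not_pole[of z]
  proof eventually_elim
    case (elim w)
    from elim(2) have "f (w + 1) \<noteq> 0"
      by (auto simp: D_def)
    moreover from this elim(2) have "f (w + 1) - 1 / f (w + 1) = f w"
      by (simp add: D_def field_simps)
    ultimately show ?case
      using elim by (simp add: sphere_map_def)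
  qed
  moreover have "((\<lambda>w. psi (sphere_map f (w + 1))) \<longlongrightarrow> psi (sphere_map f (z + 1))) (at z)"
  proof (rule isCont_tendsto_compose[OF isCont_psi])
    show "((\<lambda>w. sphere_map f (w + 1)) \<longlongrightarrow> sphere_map f (z + 1)) (at z)"
      using tendsto_sphere_map[OF nicely_meromorphic, of "z + 1"]
      unfolding at_to_0[of "z + 1"] at_to_0[of z] filterlim_filtermap by (simp add: add_ac)
  qed
  ultimately have "(sphere_map f \<longlongrightarrow> psi (sphere_map f (z + 1))) (at z)"
    by (rule iffD1[OF tendsto_cong])
  then show ?thesis
    by (rule tendsto_unique[OF at_neq_bot tendsto_sphere_map[OF nicely_meromorphic]])
qed

lemma sphere_map_eq_funpow_psi: "sphere_map f z = (psi ^^ n) (sphere_map f (z + of_nat n))"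
proof (induction n arbitrary: z)
  case (Suc n)
  have "(psi ^^ Suc n) (sphere_map f (z + of_nat (Suc n))) = (psi ^^ n) (psi (sphere_map f ((z + of_nat n) + 1)))"
    by (simp add: funpow_swap1 add_ac)
  also have "\<dots> = sphere_map f z"
    by (simp only: sphere_map_eq_psi[symmetric] Suc[symmetric])
  finally show ?case ..
qed simp

end

section \<open>Convergence of the iterates\<close>

text \<open>Re (1 / w) = Re w / |w|^2 <= 1 / Re w <= \<open>1 / lam (Suc j)\<close>, and
  \<open>lam_rec\<close> identifies the resulting lower bound as \<open>lam j\<close>.\<close>

lemma Re_psi_ge:
  fixes w :: complex
  assumes "Re w \<ge> lam (Suc j)"
  shows "Re (w - 1 / w) \<ge> lam j"
proof -
  define L where "L = lam (Suc j)"
  have L: "L > 0" "Re w \<ge> L"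
    using lam_pos assms by (auto simp: L_def simp del: lam.simps)
  have sq: "(Re w)\<^sup>2 \<le> (cmod w)\<^sup>2"
    by (simp add: cmod_power2)
  have "Re (1 / w) = Re w / (cmod w)\<^sup>2"
    by (simp add: Re_divide cmod_power2)
  also have "\<dots> \<le> Re w / (Re w)\<^sup>2"
    using sq L by (intro divide_left_mono mult_pos_pos) (auto intro!: zero_less_power)
  also have "\<dots> = 1 / Re w"
    by (simp add: power2_eq_square)
  also have "\<dots> \<le> 1 / L"
    using L by (intro divide_left_mono mult_pos_pos) auto
  finally have "Re (w - 1 / w) \<ge> L - 1 / L"
    using L by simp
  then show ?thesis
    using lam_rec[of j] by (simp add: L_def del: lam.simps)
qed

text \<open>
  The bound \<open>lam i\<^sup>2 \<ge> i\<close> limits the expansion of \<open>psi\<close> on \<open>{w. Re w \<ge> lam i}\<close> to the factor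
  \<open>(i + 1) / i\<close>, so that the product over an orbit telescopes.
\<close>

lemma psi_funpow_expansion:
  fixes w v :: complex
  assumes "Re w \<ge> lam (j + k)" "Re v \<ge> lam (j + k)" "j \<ge> 1"
  shows "\<exists>w' v'. (psi ^^ k) (Fin w) = Fin w' \<and> (psi ^^ k) (Fin v) = Fin v' \<and>
           cmod (w' - v') \<le> cmod (w - v) * (real (j + k + 1) / real (j + 1))"
  using assms
proof (induction k arbitrary: w v)
  case (Suc k)
  define L where "L = lam (j + Suc k)"
  have L: "L > 0" "L\<^sup>2 \<ge> real (j + Suc k)"
    using lam_pos[of "j + k"] lam_sq_ge[of "j + Suc k"] by (simp_all add: L_def del: lam.simps)
  have ge: "cmod w \<ge> L" "cmod v \<ge> L"
    using Suc.prems complex_Re_le_cmod[of w] complex_Re_le_cmod[of v] unfolding L_def by linarith+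
  then have ne: "w \<noteq> 0" "v \<noteq> 0"
    using L by auto
  have "Re (w - 1 / w) \<ge> lam (j + k)" "Re (v - 1 / v) \<ge> lam (j + k)"
    using Suc.prems by (intro Re_psi_ge; simp del: lam.simps)+
  then obtain w' v' where wv': "(psi ^^ k) (Fin (w - 1 / w)) = Fin w'" "(psi ^^ k) (Fin (v - 1 / v)) = Fin v'"
    "cmod (w' - v') \<le> cmod ((w - 1 / w) - (v - 1 / v)) * (real (j + k + 1) / real (j + 1))"
    using Suc.IH[of "w - 1 / w" "v - 1 / v"] Suc.prems by blast
  have "(w - 1 / w) - (v - 1 / v) = (w - v) * (1 + 1 / (w * v))"
    using ne by (simp add: field_simps)
  then have "cmod ((w - 1 / w) - (v - 1 / v)) = cmod (w - v) * cmod (1 + 1 / (w * v))"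
    by (simp only: norm_mult)
  also have "\<dots> \<le> cmod (w - v) * (1 + 1 / real (j + Suc k))"
  proof (intro mult_left_mono)
    have "cmod (1 + 1 / (w * v)) \<le> 1 + 1 / (cmod w * cmod v)"
      using norm_triangle_ineq[of 1 "1 / (w * v)"] by (simp add: norm_divide norm_mult)
    also have "real (j + Suc k) \<le> cmod w * cmod v"
    proof -
      have "L * L \<le> cmod w * cmod v"
        using ge L by (intro mult_mono) auto
      then show ?thesis
        using L by (simp add: power2_eq_square)
    qed
    then have "1 + 1 / (cmod w * cmod v) \<le> 1 + 1 / real (j + Suc k)"
      using Suc.prems ne by (intro add_left_mono divide_left_mono mult_pos_pos) auto
    finally show "cmod (1 + 1 / (w * v)) \<le> 1 + 1 / real (j + Suc k)" .
  qed simp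
  also have "1 + 1 / real (j + Suc k) = real (j + Suc k + 1) / real (j + k + 1)"
    by (simp add: field_simps)
  finally have "cmod (w' - v') \<le> cmod (w - v) * (real (j + Suc k + 1) / real (j + k + 1)) * (real (j + k + 1) / real (j + 1))"
    using wv'(3) by (meson divide_nonneg_nonneg mult_right_mono of_nat_0_le_iff order_trans)
  also have "\<dots> = cmod (w - v) * (real (j + Suc k + 1) / real (j + 1))"
    by (simp del: of_nat_add of_nat_Suc)
  finally show ?case
    using wv'(1,2) ne by (auto simp: funpow_Suc_right simp del: funpow.simps)
qed auto

text \<open>For x = \<open>lam n / lam (Suc n)\<close>, which is 1 - 1 /
  \<open>(lam (Suc n))^2\<close>, these are the bounds 1 - x <= -ln x <= (1 - x) / x.\<close>

lemma ln_lam_ratio_bounds: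
  assumes "n \<ge> 1"
  shows "1 / (lam (Suc n))\<^sup>2 \<le> ln (lam (Suc n) / lam n)"
    and "ln (lam (Suc n) / lam n) \<le> 1 / ((lam (Suc n))\<^sup>2 - 1)"
proof -
  define S where "S = lam (Suc n)"
  have n: "lam n > 0"
    using assms lam_ge_1[of n] by simp
  have S: "S > 0" "lam n = S - 1 / S"
    using lam_pos[of n] lam_rec[of n] by (simp_all add: S_def del: lam.simps)
  have "S - 1 / S > 0"
    using n S(2) by linarith
  then have "S * (S - 1 / S) > 0"
    using S(1) by (rule mult_pos_pos[rotated])
  then have S1: "S\<^sup>2 - 1 > 0"
    using S(1) by (simp add: right_diff_distrib power2_eq_square)
  have "lam n / S = 1 - 1 / S\<^sup>2"
    using S by (simp add: field_simps power2_eq_square)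
  moreover have q: "lam n / S > 0"
    using n S by simp
  moreover have ln_eq: "ln (S / lam n) = - ln (lam n / S)"
    using n S by (simp add: ln_div)
  ultimately have lo: "1 / S\<^sup>2 \<le> ln (S / lam n)"
    using ln_le_minus_one[OF q] by linarith
  have "(1 - lam n / S) / (lam n / S) = 1 / (S\<^sup>2 - 1)"
  proof -
    have "lam n / S = (S\<^sup>2 - 1) / S\<^sup>2"
      using S by (simp add: field_simps power2_eq_square)
    moreover have "1 - (S\<^sup>2 - 1) / S\<^sup>2 = 1 / S\<^sup>2"
      using S(1) by (simp add: diff_divide_distrib)
    ultimately show ?thesis
      using S(1) by simp
  qed
  then have hi: "ln (S / lam n) \<le> 1 / (S\<^sup>2 - 1)"
    using minus_ln_le[OF q] ln_eq by linarith
  show "1 / (lam (Suc n))\<^sup>2 \<le> ln (lam (Suc n) / lam n)"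
    using lo by (simp only: S_def)
  show "ln (lam (Suc n) / lam n) \<le> 1 / ((lam (Suc n))\<^sup>2 - 1)"
    using hi by (simp only: S_def)
qed

text \<open>The window for \<open>r\<close> admits the exponents of both approximating families.
  Write L = \<open>lam n\<close>: both L r and \<open>1 / lam (Suc n)\<close> lie between L / (L^2 +
  2) and L / (L^2 - 1), a gap of at most 6 / L^3. This yields the term 6 R, and the quadratic
  remainder of \<open>exp\<close> yields 12 R^2.\<close>

lemma exp_approximation:
  fixes z :: complex and r R :: real
  assumes z: "cmod z \<le> R" and n: "(lam n)\<^sup>2 \<ge> 2 * R + 2"
    and r: "1 / ((lam n)\<^sup>2 + 2) \<le> r" "r \<le> 1 / ((lam n)\<^sup>2 - 1)"
  shows "cmod (of_real (lam n) * exp (of_real r * z) - of_real (lam n) - z * of_real (1 / lam (Suc n)))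
           \<le> (12 * R\<^sup>2 + 6 * R) / lam n ^ 3"
    and "Re (of_real (lam n) * exp (of_real r * z)) \<ge> lam n - 8 * R / lam n"
proof -
  define L where "L = lam n"
  define u where "u = of_real r * z"
  have R: "R \<ge> 0"
    using z norm_ge_zero[of z] by linarith
  have L: "L > 0" "L\<^sup>2 \<ge> 2 * R + 2"
    using n lam_nonneg[of n] R by (auto simp: L_def order_less_le)
  \<comment> \<open>L^2 >= 2 gives L^2 - 1 >= L^2 / 2.\<close>
  have L2: "1 / (L\<^sup>2 - 1) \<le> 2 / L\<^sup>2"
    using L R by (simp add: field_simps)
  have rr: "0 \<le> r" "r \<le> 2 / L\<^sup>2"
  proof -
    have "0 \<le> 1 / (L\<^sup>2 + 2)"
      by simp
    then show "0 \<le> r"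
      using r unfolding L_def by linarith
    show "r \<le> 2 / L\<^sup>2"
      using r L2 unfolding L_def by linarith
  qed
  have u: "cmod u \<le> 2 * R / L\<^sup>2"
  proof -
    have "cmod u = r * cmod z"
      using rr by (simp add: u_def norm_mult)
    also have "\<dots> \<le> 2 / L\<^sup>2 * R"
      using rr z by (intro mult_mono) auto
    finally show ?thesis
      by simp
  qed
  also have "\<dots> \<le> 1"
    using L R by (simp add: divide_le_eq)
  finally have u1: "cmod u \<le> 1" .
  have e: "exp (cmod u) \<le> 3"
    using u1 exp_le order_trans[of "exp (cmod u)" "exp 1" 3] by simp
  have E: "cmod (exp u - 1 - u) \<le> 3 * (cmod u)\<^sup>2"
    using norm_exp_diff_linear_le[of u] e by (meson mult_right_mono order_trans zero_le_power2)
  have lamS: "L / (L\<^sup>2 + 2) \<le> 1 / lam (Suc n)" "1 / lam (Suc n) \<le> L / (L\<^sup>2 - 1)"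
  proof -
    define S where "S = lam (Suc n)"
    have S: "S \<ge> L" "S = L + 1 / S" "S > 0"
      using lam_mono_Suc[of n] lam_rec[of n] lam_pos[of n] by (simp_all add: S_def L_def del: lam.simps)
    have "1 / S \<le> 1 / L"
      using S L by (intro divide_left_mono) auto
    then have "S * L \<le> (L + 1 / L) * L"
      using S L by (intro mult_right_mono) auto
    also have "(L + 1 / L) * L = L\<^sup>2 + 1"
      using L by (simp add: distrib_right power2_eq_square)
    finally have "S * L \<le> L\<^sup>2 + 1" .
    then have "L / (L\<^sup>2 + 2) \<le> L / (S * L)"
      using S L by (intro divide_left_mono mult_pos_pos add_nonneg_pos) auto
    also have "\<dots> = 1 / S"
      using L by simp
    finally show "L / (L\<^sup>2 + 2) \<le> 1 / lam (Suc n)"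
      by (simp only: S_def)
    have "1 / L \<le> L / (L\<^sup>2 - 1)"
      using L R by (simp add: divide_simps power2_eq_square)
    with \<open>1 / S \<le> 1 / L\<close> show "1 / lam (Suc n) \<le> L / (L\<^sup>2 - 1)"
      unfolding S_def by linarith
  qed
  have Lr: "L / (L\<^sup>2 + 2) \<le> L * r" "L * r \<le> L / (L\<^sup>2 - 1)"
    using mult_left_mono[OF r(1), of L] mult_left_mono[OF r(2), of L] L by (simp_all add: L_def[symmetric])
  have diff: "\<bar>L * r - 1 / lam (Suc n)\<bar> \<le> 6 / L ^ 3"
  proof -
    have "L / (L\<^sup>2 - 1) - L / (L\<^sup>2 + 2) = 3 * L * (1 / (L\<^sup>2 - 1)) * (1 / (L\<^sup>2 + 2))"
      using L R by (simp add: divide_simps add_pos_pos) (simp add: algebra_simps)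
    also have "\<dots> \<le> 3 * L * (2 / L\<^sup>2) * (1 / L\<^sup>2)"
      using L L2 R by (intro mult_mono divide_left_mono) (auto intro!: mult_pos_pos add_pos_pos)
    also have "\<dots> = 6 / L ^ 3"
      using L by (simp add: power2_eq_square power3_eq_cube)
    finally show ?thesis
      using Lr lamS by linarith
  qed
  have "of_real L * exp u - of_real L - z * of_real (1 / lam (Suc n))
      = of_real L * (exp u - 1 - u) + z * of_real (L * r - 1 / lam (Suc n))"
    by (simp add: u_def algebra_simps del: lam.simps)
  then have "cmod (of_real L * exp u - of_real L - z * of_real (1 / lam (Suc n)))
      \<le> cmod (of_real L * (exp u - 1 - u)) + cmod (z * of_real (L * r - 1 / lam (Suc n)))"
    by (simp only: norm_triangle_ineq)
  also have "\<dots> = L * cmod (exp u - 1 - u) + cmod z * \<bar>L * r - 1 / lam (Suc n)\<bar>"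
    using L by (simp only: norm_mult norm_of_real abs_of_pos)
  also have "\<dots> \<le> L * (3 * (2 * R / L\<^sup>2)\<^sup>2) + R * (6 / L ^ 3)"
  proof (intro add_mono mult_mono)
    have "(cmod u)\<^sup>2 \<le> (2 * R / L\<^sup>2)\<^sup>2"
      using u by (intro power_mono) auto
    then show "cmod (exp u - 1 - u) \<le> 3 * (2 * R / L\<^sup>2)\<^sup>2"
      using E by linarith
  qed (use L R z diff in auto)
  also have "\<dots> = (12 * R\<^sup>2 + 6 * R) / L ^ 3"
    using L by (simp add: field_simps power2_eq_square power3_eq_cube)
  finally show "cmod (of_real (lam n) * exp (of_real r * z) - of_real (lam n) - z * of_real (1 / lam (Suc n)))
           \<le> (12 * R\<^sup>2 + 6 * R) / lam n ^ 3"
    by (simp only: u_def L_def)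
  have "cmod (exp u - 1) \<le> cmod (exp u - 1 - u) + cmod u"
    using norm_triangle_ineq[of "exp u - 1 - u" u] by simp
  also have "\<dots> \<le> 3 * cmod u + cmod u"
    using E mult_left_mono[OF u1, of "cmod u"] by (simp add: power2_eq_square)
  also have "\<dots> \<le> 8 * R / L\<^sup>2"
    using u by simp
  finally have "\<bar>Re (exp u - 1)\<bar> \<le> 8 * R / L\<^sup>2"
    using abs_Re_le_cmod order_trans by blast
  then have "Re (exp u) \<ge> 1 - 8 * R / L\<^sup>2"
    by simp
  then have "L * Re (exp u) \<ge> L * (1 - 8 * R / L\<^sup>2)"
    using L by (intro mult_left_mono) auto
  also have "L * (1 - 8 * R / L\<^sup>2) = L - 8 * R / L"
    using L by (simp add: right_diff_distrib power2_eq_square)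
  finally show "Re (of_real (lam n) * exp (of_real r * z)) \<ge> lam n - 8 * R / lam n"
    by (simp add: u_def L_def)
qed

section \<open>Uniform convergence on discs\<close>

context bernstein_extension
begin

text \<open>With L = \<open>lam (n - M)\<close>, the starting points differ by at most C / L^3. The
  first n - M - 1 iterations expand this by at most L^2, and the last M + 1 cost the constant 4^(M +
  1) in the chordal metric, which leaves a multiple of 1 / L.\<close>

lemma uniform_limit_psi_funpow_exp:
  fixes c :: "nat \<Rightarrow> complex \<Rightarrow> complex" and r :: "nat \<Rightarrow> real"
  assumes c: "\<And>n z. n \<ge> 2 \<Longrightarrow> c n z = of_real (lam n) * exp (of_real (r n) * z)"
    and r: "\<And>n. n \<ge> 2 \<Longrightarrow> 1 / ((lam n)\<^sup>2 + 2) \<le> r n" "\<And>n. n \<ge> 2 \<Longrightarrow> r n \<le> 1 / ((lam n)\<^sup>2 - 1)"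
    and R: "R \<ge> 0"
  shows "uniform_limit (cball 0 R) (\<lambda>n z. (psi ^^ n) (Fin (c n z))) (sphere_map f) sequentially"
proof -
  \<comment> \<open>8 R <= M keeps \<open>c n z\<close> in the half plane of index n - M; R + 2 <= M
    is what the expansion of the transform requires.\<close>
  obtain M where M: "real M \<ge> 8 * R + 2"
    using real_arch_simple by blast
  define C where "C = 12 * R\<^sup>2 + 6 * R + (R + R\<^sup>2)"
  have C: "C \<ge> 0"
    using R by (simp add: C_def)
  have bound: "dist ((psi ^^ n) (Fin (c n z))) (sphere_map f z) \<le> 4 ^ (M + 1) * (2 * C) / lam (n - M)"
    if n: "n \<ge> 2 * M + 2" and z: "z \<in> cball 0 R" for n z
  proof -
    have z': "cmod z \<le> R"
      using z by simp
    have Mn: "real M \<le> n" "M \<ge> 2" "M \<le> n" "n \<ge> 2"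
      using n M R by linarith+
    have lam_n: "(lam n)\<^sup>2 \<ge> 2 * R + 2"
      using lam_sq_ge[of n] n M R by linarith
    define L where "L = lam (n - M)"
    have "n - M \<ge> 1"
      using n by simp
    then have L: "L > 0" "L\<^sup>2 \<ge> real (n - M)"
      using lam_ge_1[of "n - M"] lam_sq_ge[of "n - M"] n by (simp_all add: L_def)
    note exp_approx = exp_approximation[OF z' lam_n r(1)[OF Mn(4)] r(2)[OF Mn(4)]]
    have LL: "L \<le> lam n"
      unfolding L_def by (intro lam_mono) simp
    \<comment> \<open>Going back \<open>M\<close> indices lowers \<open>lam\<close> by at least M /
      \<open>lam n\<close>, which covers the loss 8 R / \<open>lam n\<close> in the real part of
      \<open>c n z\<close>.\<close>
    have "L + real M / lam n \<le> lam n"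
      using lam_add_ge[of "n - M" M] n by (simp add: L_def)
    moreover have "8 * R / lam n \<le> real M / lam n"
      using M LL L by (intro divide_right_mono) auto
    ultimately have Re_c: "Re (c n z) \<ge> L"
      using exp_approx(2) unfolding c[OF Mn(4)] by linarith
    have "Re (of_nat n + z) \<ge> real (n - M)"
      using abs_Re_le_cmod[of z] z' M R Mn by (simp add: of_nat_diff)
    then have Re_f: "Re (f (of_nat n + z)) \<ge> L" and Re_nz: "Re (of_nat n + z) > 0"
      using n Re_bernstein_transform_ge[of "n - M" "of_nat n + z"] eq_bernstein[of "of_nat n + z"]
      by (auto simp: L_def)
    have err: "cmod (c n z - f (of_nat n + z)) \<le> C / L ^ 3"
    proof -
      \<comment> \<open>For consecutive terms S and T the recursion gives T - S = 1 / T, so the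
        difference of reciprocals is 1 / (S T^2).\<close>
      have "1 / lam (Suc (n - M)) - 1 / lam (Suc (n - M + 1)) \<le> 1 / L ^ 3"
      proof -
        define S T where "S = lam (Suc (n - M))" and "T = lam (Suc (n - M + 1))"
        have ST: "S \<ge> L" "T \<ge> L" "T - S = 1 / T" "S > 0" "T > 0"
          using lam_mono[of "n - M" "Suc (n - M)"] lam_mono[of "n - M" "Suc (n - M + 1)"]
            lam_rec[of "n - M + 1"] lam_pos[of "n - M"] lam_pos[of "n - M + 1"]
          by (simp_all add: S_def T_def L_def del: lam.simps)
        have "1 / S - 1 / T = (T - S) / (S * T)"
          using ST by (simp add: field_simps)
        also have "\<dots> = 1 / (S * T * T)"
          using ST by simp
        also have "\<dots> \<le> 1 / (L * L * L)"
          using ST L by (intro divide_left_mono mult_mono mult_pos_pos) auto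
        finally show ?thesis
          by (simp add: S_def T_def power3_eq_cube)
      qed
      then have "(R + R\<^sup>2) * (1 / lam (Suc (n - M)) - 1 / lam (Suc (n - M + 1))) \<le> (R + R\<^sup>2) * (1 / L ^ 3)"
        using R by (intro mult_left_mono) auto
      moreover have "R + 2 \<le> real M"
        using M R by linarith
      ultimately have "cmod (f (of_nat n + z) - of_real (lam n) - z * of_real (1 / lam (Suc n))) \<le> (R + R\<^sup>2) * (1 / L ^ 3)"
        using bernstein_transform_expansion[OF z' _ Mn(3)] eq_bernstein[OF Re_nz]
        by (metis order_trans)
      moreover have "cmod (c n z - of_real (lam n) - z * of_real (1 / lam (Suc n))) \<le> (12 * R\<^sup>2 + 6 * R) / L ^ 3"
      proof -
        have "(12 * R\<^sup>2 + 6 * R) / lam n ^ 3 \<le> (12 * R\<^sup>2 + 6 * R) / L ^ 3"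
          using LL L R by (intro divide_left_mono power_mono mult_pos_pos) auto
        then show ?thesis
          using exp_approx(1) unfolding c[OF Mn(4)] by linarith
      qed
      ultimately have "cmod (c n z - f (of_nat n + z)) \<le> (12 * R\<^sup>2 + 6 * R) / L ^ 3 + (R + R\<^sup>2) * (1 / L ^ 3)"
        using norm_triangle_ineq4[of "c n z - of_real (lam n) - z * of_real (1 / lam (Suc n))"
            "f (of_nat n + z) - of_real (lam n) - z * of_real (1 / lam (Suc n))"] by simp
      then show ?thesis
        by (simp add: C_def add_divide_distrib)
    qed
    \<comment> \<open>The half-plane index runs from n - M = 1 + k down to 1; the other M + 1 of the
      n iterations are left to the chordal Lipschitz bound.\<close>
    define k where "k = n - M - 1"
    have nk: "n = (M + 1) + k" "n - M = 1 + k"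
      using n by (auto simp: k_def)
    obtain w v where wv: "(psi ^^ k) (Fin (c n z)) = Fin w" "(psi ^^ k) (Fin (f (of_nat n + z))) = Fin v"
      "cmod (w - v) \<le> cmod (c n z - f (of_nat n + z)) * (real (1 + k + 1) / real (1 + 1))"
      using psi_funpow_expansion[of 1 k "c n z" "f (of_nat n + z)"] Re_c Re_f
      unfolding L_def nk(2) by auto
    have "sphere_map f z = (psi ^^ n) (sphere_map f (z + of_nat n))"
      by (rule sphere_map_eq_funpow_psi)
    also have "sphere_map f (z + of_nat n) = Fin (f (of_nat n + z))"
      using not_is_pole[OF Re_nz] by (simp add: sphere_map_def add.commute)
    also have "(psi ^^ n) \<dots> = (psi ^^ (M + 1)) (Fin v)"
      unfolding nk(1) funpow_add o_apply using wv(2) by (simp only: nk(1)[symmetric])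
    finally have fz: "sphere_map f z = (psi ^^ (M + 1)) (Fin v)" .
    have cz: "(psi ^^ n) (Fin (c n z)) = (psi ^^ (M + 1)) (Fin w)"
      using wv(1) funpow_add[of "M + 1" k psi] by (simp only: nk(1)[symmetric] o_apply)
    have "dist ((psi ^^ n) (Fin (c n z))) (sphere_map f z) \<le> 4 ^ (M + 1) * dist (Fin w) (Fin v)"
      unfolding fz cz by (rule dist_psi_funpow_le)
    also have "\<dots> \<le> 4 ^ (M + 1) * (2 * cmod (w - v))"
      using chordal_Fin_le[of w v] by (intro mult_left_mono) (auto simp: dist_riemann_sphere_def dist_norm)
    also have "\<dots> \<le> 4 ^ (M + 1) * (2 * (C / L ^ 3 * L\<^sup>2))"
    proof (intro mult_left_mono)
      have "real (1 + k + 1) / real (1 + 1) \<le> L\<^sup>2"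
        using L(2) nk(2) by simp
      then have "cmod (c n z - f (of_nat n + z)) * (real (1 + k + 1) / real (1 + 1)) \<le> C / L ^ 3 * L\<^sup>2"
        using err L C by (intro mult_mono) auto
      then show "cmod (w - v) \<le> C / L ^ 3 * L\<^sup>2"
        using wv(3) by linarith
    qed auto
    also have "C / L ^ 3 * L\<^sup>2 = C / L"
      using L by (simp add: power2_eq_square power3_eq_cube)
    finally show ?thesis
      by (simp add: L_def)
  qed
  show ?thesis
    unfolding uniform_limit_iff
  proof (intro allI impI)
    fix e :: real assume "e > 0"
    have "(\<lambda>n. 4 ^ (M + 1) * (2 * C) / lam (n - M)) \<longlonglongrightarrow> 0"
      by (rule tendsto_divide_0[OF tendsto_const
          filterlim_at_top_imp_at_infinity[OF filterlim_compose[OF lam_tendsto_at_top filterlim_minus_const_nat_at_top]]])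
    then have "\<forall>\<^sub>F n in sequentially. 4 ^ (M + 1) * (2 * C) / lam (n - M) < e"
      using \<open>e > 0\<close> by (rule order_tendstoD)
    with eventually_ge_at_top[of "2 * M + 2"]
    show "\<forall>\<^sub>F n in sequentially. \<forall>z\<in>cball 0 R. dist ((psi ^^ n) (Fin (c n z))) (sphere_map f z) < e"
      by eventually_elim (use bound in \<open>meson le_less_trans\<close>)
  qed
qed

text \<open>The exponent is ln (\<open>lam n / lam (n - 1)\<close>). The ratio bounds at index n - 1
  are expressed in \<open>lam n\<close> and fall directly into the window.\<close>

lemma uniform_limit_a_fun:
  assumes "R \<ge> 0"
  shows "uniform_limit (cball 0 R) (\<lambda>n z. (psi ^^ n) (Fin (a_fun n z))) (sphere_map f) sequentially"
proof (rule uniform_limit_psi_funpow_exp[OF _ _ _ assms])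
  fix n :: nat assume "n \<ge> 2"
  then obtain k where k: "n = Suc k" "k \<ge> 1"
    by (cases n) auto
  have pos: "lam n / lam (n - 1) > 0"
    using k lam_pos[of k] lam_ge_1[of k] by (simp del: lam.simps)
  show "a_fun n z = of_real (lam n) * exp (of_real (ln (lam n / lam (n - 1))) * z)" for z
    unfolding a_fun_def by (simp only: of_real_powr_eq_exp[OF pos])
  have "1 / ((lam n)\<^sup>2 + 2) \<le> 1 / (lam n)\<^sup>2"
    using lam_pos[of k] k by (intro divide_left_mono) (auto intro!: mult_pos_pos add_pos_pos simp del: lam.simps)
  then show "1 / ((lam n)\<^sup>2 + 2) \<le> ln (lam n / lam (n - 1))"
    using ln_lam_ratio_bounds(1)[of k] k by (simp del: lam.simps)
  show "ln (lam n / lam (n - 1)) \<le> 1 / ((lam n)\<^sup>2 - 1)"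
    using ln_lam_ratio_bounds(2)[of k] k by (simp del: lam.simps)
qed

text \<open>The exponent is ln (\<open>lam (n + 1) / lam n\<close>), with bounds in terms of
  \<open>lam (n + 1)\<close>. Its square lies between those of \<open>lam n\<close> plus 1 and plus
  2, which accounts for the 2 in the lower end of the window.\<close>

lemma uniform_limit_b_fun:
  assumes "R \<ge> 0"
  shows "uniform_limit (cball 0 R) (\<lambda>n z. (psi ^^ n) (Fin (b_fun n z))) (sphere_map f) sequentially"
proof (rule uniform_limit_psi_funpow_exp[OF _ _ _ assms])
  fix n :: nat assume n: "n \<ge> 2"
  have "lam n > 0"
    using lam_ge_1[of n] n by simp
  then have pos: "lam (n + 1) / lam n > 0"
    using lam_pos[of n] by (simp del: lam.simps)
  show "b_fun n z = of_real (lam n) * exp (of_real (ln (lam (n + 1) / lam n)) * z)" for z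
    unfolding b_fun_def by (simp only: of_real_powr_eq_exp[OF pos])
  have sq: "(lam n)\<^sup>2 \<ge> 2"
    using lam_sq_ge[of n] n by linarith
  have "1 / ((lam n)\<^sup>2 + 2) \<le> 1 / (lam (Suc n))\<^sup>2"
    using lam_sq_Suc_le[of n] lam_pos[of n]
    by (intro divide_left_mono mult_pos_pos) (auto intro: add_nonneg_pos simp del: lam.simps)
  then show "1 / ((lam n)\<^sup>2 + 2) \<le> ln (lam (n + 1) / lam n)"
    using ln_lam_ratio_bounds(1)[of n] n by (simp del: lam.simps)
  have "1 / ((lam (Suc n))\<^sup>2 - 1) \<le> 1 / ((lam n)\<^sup>2 - 1)"
    using lam_sq_Suc_ge[of n] sq by (intro divide_left_mono mult_pos_pos) (auto simp del: lam.simps)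
  then show "ln (lam (n + 1) / lam n) \<le> 1 / ((lam n)\<^sup>2 - 1)"
    using ln_lam_ratio_bounds(2)[of n] n by (simp del: lam.simps)
qed

end

theorem theorem1p3:
  fixes \<mu> :: "real measure" and f :: "complex \<Rightarrow> complex"
  assumes "fixed_point_measure \<mu>"
    and "f nicely_meromorphic_on UNIV"
    and "\<And>z. Re z > 0 \<Longrightarrow> f z = bernstein_transform \<mu> z"
  shows "(\<forall>z. (\<lambda>n. (psi ^^ n) (Fin (a_fun n z))) \<longlonglongrightarrow> sphere_map f z) \<and>
         (\<forall>z. (\<lambda>n. (psi ^^ n) (Fin (b_fun n z))) \<longlonglongrightarrow> sphere_map f z) \<and>
         (\<forall>K. compact K \<longrightarrow>
            uniform_limit K (\<lambda>n z. (psi ^^ n) (Fin (a_fun n z))) (sphere_map f) sequentially \<and>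
            uniform_limit K (\<lambda>n z. (psi ^^ n) (Fin (b_fun n z))) (sphere_map f) sequentially)"
proof -
  interpret bernstein_extension \<mu> f
    by standard (use assms in auto)
  \<comment> \<open>The point \<open>z\<close> lies in the closed disc of radius |z|, on which the
    convergence is uniform.\<close>
  have "(\<lambda>n. (psi ^^ n) (Fin (a_fun n z))) \<longlonglongrightarrow> sphere_map f z"
    and "(\<lambda>n. (psi ^^ n) (Fin (b_fun n z))) \<longlonglongrightarrow> sphere_map f z" for z
    using tendsto_uniform_limitI[OF uniform_limit_a_fun, of "cmod z" z]
      tendsto_uniform_limitI[OF uniform_limit_b_fun, of "cmod z" z] by simp_all
  moreover have "uniform_limit K (\<lambda>n z. (psi ^^ n) (Fin (a_fun n z))) (sphere_map f) sequentially \<and>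
      uniform_limit K (\<lambda>n z. (psi ^^ n) (Fin (b_fun n z))) (sphere_map f) sequentially" if "compact K" for K
  proof -
    have "bounded K"
      using that by (rule compact_imp_bounded)
    then obtain R where R: "R > 0" "\<And>z. z \<in> K \<Longrightarrow> cmod z \<le> R"
      by (auto simp: bounded_pos)
    then have "R \<ge> 0" and "K \<subseteq> cball 0 R"
      by auto
    then show ?thesis
      using uniform_limit_on_subset[OF uniform_limit_a_fun] uniform_limit_on_subset[OF uniform_limit_b_fun]
      by blast
  qed
  ultimately show ?thesis
    by blast
qed

end
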